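(* Let $X$ be a binary symmetric source (i.i.d., uniform on $\{0,1\}$) with reconstruction alphabet $\{0,1\}$ and Hamming distortion $d(x,\hat x)=\mathbf{1}\{x\ne\hat x\}$. Then for $0\le D_{\{1,2\}}\le D_{\{1\}}\le\frac12$, $$D^*_{\{2\}}(D_{\{1\}},D_{\{1,2\}})=\frac12+D_{\{1,2\}}-D_{\{1\}}.$$
   Context: For an i.i.d. source $\{X(t)\}_{t\ge1}$ with marginal $p_X$ on a finite set $\mathcal{X}$, reconstruction set $\hat{\mathcal{X}}$ and distortion measure $d$, a tuple $(R_1,R_2,D_{\{1\}},D_{\{2\}},D_{\{1,2\}})$ is achievable if for every $\epsilon>0$ and all sufficiently large $n$ there exist encoders $f_k^{(n)}:\mathcal{X}^n\to\mathcal{C}_k^{(n)}$, $k=1,2$, and decoders $g_{\mathcal{K}}^{(n)}:\prod_{k\in\mathcal{K}}\mathcal{C}_k^{(n)}\to\hat{\mathcal{X}}^n$, $\mathcal{K}\in\{\{1\},\{2\},\{1,2\}\}$, with $\frac1n\log|\mathcal{C}_k^{(n)}|\le R_k+\epsilon$ and $\frac1n\sum_{t=1}^n\mathbb{E}[d(X(t),\hat X_{\mathcal{K}}(t))]\le D_{\mathcal{K}}+\epsilon$, where $\hat X_{\mathcal{K}}^n=g^{(n)}_{\mathcal{K}}(f_k^{(n)}(X^n),k\in\mathcal{K})$. $\mathcal{RD}_{\text{MD}}$ is the set of achievable tuples. The scalable coding region $\mathcal{RD}_{\text{SC}}$ is the set of $(R_1,R_2,D_{\{1\}},D_{\{1,2\}})$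 such that $(R_1,R_2,D_{\{1\}},\infty,D_{\{1,2\}})\in\mathcal{RD}_{\text{MD}}$. Define $R(R_1,D_{\{1\}},D_{\{1,2\}})=\min\{R_1+R_2:(R_1,R_2,D_{\{1\}},D_{\{1,2\}})\in\mathcal{RD}_{\text{SC}}\}$, $R(D)=\min_{p_{\hat X|X}:\mathbb{E}[d(X,\hat X)]\le D}I(X;\hat X)$, and $D^*_{\{2\}}(D_{\{1\}},D_{\{1,2\}})=\min\{D_{\{2\}}: R_1=R(D_{\{1\}}),\ R_1+R_2=R(R_1,D_{\{1\}},D_{\{1,2\}}),\ (R_1,R_2,D_{\{1\}},D_{\{2\}},D_{\{1,2\}})\in\mathcal{RD}_{\text{MD}}\}$. *)

theory Defs
  imports Complex_Main "HOL-Library.Extended_Real"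
begin

text \<open>General finite-alphabet setting: source alphabet 'a (finite type), reconstruction
alphabet 'b (finite type), source marginal p, distortion measure d.
Length-n source sequences are lists of length n; reconstruction sequences are functions
nat => 'b, of which only the positions t < n matter. Codebook C_k is {..<M_k}.
Rates are measured in bits (log base 2).\<close>

definition seq_prob :: "('a \<Rightarrow> real) \<Rightarrow> 'a list \<Rightarrow> real" where
  "seq_prob p xs = (\<Prod>t<length xs. p (xs ! t))"

definition exp_dist ::
  "('a \<Rightarrow> real) \<Rightarrow> ('a \<Rightarrow> 'b \<Rightarrow> real) \<Rightarrow> nat \<Rightarrow> ('a list \<Rightarrow> nat \<Rightarrow> 'b) \<Rightarrow> real" where
  "exp_dist p d n g =
     (\<Sum>xs\<in>{xs. length xs = n}. seq_prob p xs * ((1 / real n) * (\<Sum>t<n. d (xs ! t) (g xs t))))"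

definition md_code_ok ::
  "('a \<Rightarrow> real) \<Rightarrow> ('a \<Rightarrow> 'b \<Rightarrow> real) \<Rightarrow> real \<Rightarrow> real \<Rightarrow> ereal \<Rightarrow> ereal \<Rightarrow> ereal \<Rightarrow> real \<Rightarrow> nat \<Rightarrow>
   nat \<Rightarrow> nat \<Rightarrow> ('a list \<Rightarrow> nat) \<Rightarrow> ('a list \<Rightarrow> nat) \<Rightarrow>
   (nat \<Rightarrow> nat \<Rightarrow> 'b) \<Rightarrow> (nat \<Rightarrow> nat \<Rightarrow> 'b) \<Rightarrow> (nat \<Rightarrow> nat \<Rightarrow> nat \<Rightarrow> 'b) \<Rightarrow> bool" where
  "md_code_ok p d R1 R2 D1 D2 D12 eps n M1 M2 f1 f2 g1 g2 g12 \<longleftrightarrow>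
     (\<forall>xs. length xs = n \<longrightarrow> f1 xs < M1 \<and> f2 xs < M2) \<and>
     log 2 (real M1) / real n \<le> R1 + eps \<and>
     log 2 (real M2) / real n \<le> R2 + eps \<and>
     ereal (exp_dist p d n (\<lambda>xs. g1 (f1 xs))) \<le> D1 + ereal eps \<and>
     ereal (exp_dist p d n (\<lambda>xs. g2 (f2 xs))) \<le> D2 + ereal eps \<and>
     ereal (exp_dist p d n (\<lambda>xs. g12 (f1 xs) (f2 xs))) \<le> D12 + ereal eps"

definition md_achievable ::
  "('a \<Rightarrow> real) \<Rightarrow> ('a \<Rightarrow> 'b \<Rightarrow> real) \<Rightarrow> real \<Rightarrow> real \<Rightarrow> ereal \<Rightarrow> ereal \<Rightarrow> ereal \<Rightarrow> bool" where
  "md_achievable p d R1 R2 D1 D2 D12 \<longleftrightarrow>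
     (\<forall>eps>0. \<exists>N. \<forall>n\<ge>N. \<exists>M1 M2 f1 f2 g1 g2 g12.
        md_code_ok p d R1 R2 D1 D2 D12 eps n M1 M2 f1 f2 g1 g2 g12)"

definition sc_achievable ::
  "('a \<Rightarrow> real) \<Rightarrow> ('a \<Rightarrow> 'b \<Rightarrow> real) \<Rightarrow> real \<Rightarrow> real \<Rightarrow> ereal \<Rightarrow> ereal \<Rightarrow> bool" where
  "sc_achievable p d R1 R2 D1 D12 \<longleftrightarrow> md_achievable p d R1 R2 D1 \<infinity> D12"

definition sc_sum_rate ::
  "('a \<Rightarrow> real) \<Rightarrow> ('a \<Rightarrow> 'b \<Rightarrow> real) \<Rightarrow> real \<Rightarrow> ereal \<Rightarrow> ereal \<Rightarrow> real" where
  "sc_sum_rate p d R1 D1 D12 = Inf {R1 + R2 | R2. sc_achievable p d R1 R2 D1 D12}"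

definition mutual_info :: "('a::finite \<Rightarrow> real) \<Rightarrow> ('a \<Rightarrow> 'b::finite \<Rightarrow> real) \<Rightarrow> real" where
  "mutual_info p W =
     (\<Sum>x\<in>UNIV. \<Sum>y\<in>UNIV.
        if p x * W x y = 0 then 0
        else p x * W x y * log 2 (W x y / (\<Sum>x'\<in>UNIV. p x' * W x' y)))"

definition is_channel :: "('a \<Rightarrow> 'b::finite \<Rightarrow> real) \<Rightarrow> bool" where
  "is_channel W \<longleftrightarrow> (\<forall>x y. 0 \<le> W x y) \<and> (\<forall>x. (\<Sum>y\<in>UNIV. W x y) = 1)"

definition rate_dist :: "('a::finite \<Rightarrow> real) \<Rightarrow> ('a \<Rightarrow> 'b::finite \<Rightarrow> real) \<Rightarrow> real \<Rightarrow> real" where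
  "rate_dist p d D = Inf {mutual_info p W | W. is_channel W \<and>
      (\<Sum>x\<in>UNIV. \<Sum>y\<in>UNIV. p x * W x y * d x y) \<le> D}"

text \<open>The set whose minimum is D*_{2}(D1, D12).\<close>
definition Dstar2_set ::
  "('a::finite \<Rightarrow> real) \<Rightarrow> ('a \<Rightarrow> 'b::finite \<Rightarrow> real) \<Rightarrow> real \<Rightarrow> real \<Rightarrow> ereal set" where
  "Dstar2_set p d D1 D12 = {D2. \<exists>R1 R2.
      R1 = rate_dist p d D1 \<and>
      R1 + R2 = sc_sum_rate p d R1 (ereal D1) (ereal D12) \<and>
      md_achievable p d R1 R2 (ereal D1) D2 (ereal D12)}"

definition bss :: "bool \<Rightarrow> real" where "bss x = 1 / 2"
definition hamming :: "bool \<Rightarrow> bool \<Rightarrow> real" where "hamming x y = (if x \<noteq> y then 1 else 0)"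

end

theory Submission
  imports Defs "HOL-Library.NList"
begin

text \<open>Converse. Write the source bits, and the reconstructions \<open>a\<close>, \<open>b\<close>, \<open>c\<close> of the first, second and
  joint decoder, as signs. A code without excess sum rate has \<open>E[x | messages]\<close> close to
  \<open>(1 - 2 D12) c\<close>, a first description at the rate-distortion limit has \<open>E[x | first message]\<close>
  close to \<open>(1 - 2 D1) a\<close>, and the two messages are nearly independent. As the source is uniform, the
  total correlation of \<open>E[x | first message]\<close> with any independent sign sequence is subgaussian, so
  that the average of \<open>a b\<close> is asymptotically at most 0. Averaging \<open>c (a + b) \<le> 1 + a b\<close> gives
  \<open>E[x b] \<le> 2 D1 - 2 D12\<close>, which is the claimed bound on the second distortion.

  Achievability. Random codebooks of fair bits \<open>a\<close> and of independent symbols \<open>u\<close> that either fix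
  the joint reconstruction or leave it to \<open>a\<close>: the second decoder errs with probability \<open>D12\<close> in the
  first case and \<open>1/2\<close> in the other, and concavity of the entropy shows that the rates suffice.\<close>

section \<open>Independent sampling from a finite distribution\<close>

text \<open>Achievability gives the rate and distortion constraints only up to a slack, so every
  structural fact about an optimal code is needed in a quantitative form. One device supplies all of
  them: Jensen's inequality for \<open>ln\<close>, applied to a density ratio whose average over
  source words is bounded by summing over messages. A tilt of strength \<theta> in that density
  turns a slack \<kappa> into a correlation bound of order \<kappa> / \<theta> + \<theta>; \<theta>
  is fixed first, and \<kappa> then made small.

  Both descriptions are forced to be tight at once because the source is successively refinable:
  starting from the rate R(D1), the minimal sum rate is R(D12) itself. The correlation of a and b is
  reached through (1 - 2 D1) E[a b], so D1 = 1/2 needs an argument of its own.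

  In the direct part the logarithms of the test channel are finite only for a positive crossover
  probability. Codes are therefore built at interior points, and continuity of the entropy reaches
  the boundary.\<close>

lemma finite_nlists [simp]: "finite S \<Longrightarrow> finite (nlists n S)"
  unfolding nlists_def by (rule finite_subset[OF _ finite_lists_length_eq[of S n]]) auto

text \<open>The factor may depend on the position, so that averages with another sequence held
  fixed, such as those of \<open>pU u * W (a!t) u (x!t)\<close>, factorise as well.\<close>

lemma sum_nlists_prod:
  fixes F :: "nat \<Rightarrow> 'a \<Rightarrow> 'b::comm_semiring_1"
  assumes "finite S"
  shows "(\<Sum>xs\<in>nlists n S. \<Prod>t<n. F t (xs ! t)) = (\<Prod>t<n. \<Sum>a\<in>S. F t a)"
proof (induction n arbitrary: F)
  case 0
  then show ?case by simp
next
  case (Suc n)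
  have "bij_betw (\<lambda>(a, xs). a # xs) (S \<times> nlists n S) (nlists (Suc n) S)"
    by (auto simp: bij_betw_def inj_on_def nlists_Suc)
  then have "(\<Sum>xs\<in>nlists (Suc n) S. \<Prod>t<Suc n. F t (xs ! t))
      = (\<Sum>z\<in>S \<times> nlists n S. \<Prod>t<Suc n. F t ((case z of (a, xs) \<Rightarrow> a # xs) ! t))"
    by (rule sum.reindex_bij_betw[symmetric])
  also have "\<dots> = (\<Sum>(a, xs)\<in>S \<times> nlists n S. F 0 a * (\<Prod>t<n. F (Suc t) (xs ! t)))"
    by (intro sum.cong refl) (auto simp: prod.lessThan_Suc_shift simp del: prod.lessThan_Suc)
  also have "\<dots> = (\<Sum>a\<in>S. F 0 a) * (\<Sum>xs\<in>nlists n S. \<Prod>t<n. F (Suc t) (xs ! t))"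
    unfolding sum_product by (rule sum.cartesian_product[symmetric])
  also have "\<dots> = (\<Sum>a\<in>S. F 0 a) * (\<Prod>t<n. \<Sum>a\<in>S. F (Suc t) a)"
    by (simp only: Suc.IH[of "\<lambda>t. F (Suc t)"])
  finally show ?case
    by (simp only: prod.lessThan_Suc_shift)
qed

lemma sum_nlists_zip:
  "(\<Sum>zs\<in>nlists n (S \<times> T). F zs) = (\<Sum>xs\<in>nlists n S. \<Sum>ys\<in>nlists n T. F (zip xs ys))"
proof -
  have "(\<Sum>zs\<in>nlists n (S \<times> T). F zs) = (\<Sum>(xs, ys)\<in>nlists n S \<times> nlists n T. F (zip xs ys))"
    unfolding nlists_def
    by (rule sum.reindex_bij_witness[where i = "\<lambda>(xs, ys). zip xs ys"
          and j = "\<lambda>zs. (map fst zs, map snd zs)"])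
       (auto simp: zip_map_fst_snd dest: set_zip_leftD set_zip_rightD)
  then show ?thesis by (simp add: sum.cartesian_product)
qed

lemma seq_prob_nlists: "xs \<in> nlists n S \<Longrightarrow> seq_prob p xs = (\<Prod>t<n. p (xs ! t))"
  by (simp add: seq_prob_def)

lemma seq_prob_nonneg:
  assumes "xs \<in> nlists n S" "\<And>a. a \<in> S \<Longrightarrow> 0 \<le> p a"
  shows "0 \<le> seq_prob p xs"
  unfolding seq_prob_nlists[OF assms(1)]
  by (intro prod_nonneg) (use assms nlistsE_nth_in in fastforce)

text \<open>The carrier is a set so that the locale can be iterated through
  \<open>fin_dist_nlists\<close>: letters, sequences of letters and codebooks of sequences are all
  instances.\<close>

locale fin_dist =
  fixes S :: "'a set" and p :: "'a \<Rightarrow> real"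
  assumes fin: "finite S" and nonneg: "\<And>a. a \<in> S \<Longrightarrow> 0 \<le> p a" and sum1: "(\<Sum>a\<in>S. p a) = 1"
begin

lemma sum_seq_prob: "(\<Sum>xs\<in>nlists n S. seq_prob p xs) = 1"
  using sum_nlists_prod[OF fin, where n = n and F = "\<lambda>_. p"] by (simp add: seq_prob_nlists sum1)

lemma fin_dist_nlists: "fin_dist (nlists n S) (seq_prob p)"
  using fin nonneg by unfold_locales (auto intro: seq_prob_nonneg sum_seq_prob)

lemma sum_seq_prob_nth2:
  assumes "i < n" "j < n" "i \<noteq> j"
  shows "(\<Sum>xs\<in>nlists n S. seq_prob p xs * (f (xs ! i) * g (xs ! j)))
    = (\<Sum>a\<in>S. p a * f a) * (\<Sum>a\<in>S. p a * g a)"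
proof -
  define F where "F t a = p a * ((if t = i then f a else 1) * (if t = j then g a else 1))" for t a
  have "(\<Sum>xs\<in>nlists n S. seq_prob p xs * (f (xs ! i) * g (xs ! j)))
      = (\<Sum>xs\<in>nlists n S. \<Prod>t<n. F t (xs ! t))"
    using assms by (intro sum.cong refl)
      (simp add: F_def prod.distrib seq_prob_nlists)
  also have "\<dots> = (\<Prod>t<n. \<Sum>a\<in>S. F t a)"
    by (rule sum_nlists_prod[OF fin])
  also have "\<dots> = (\<Prod>t<n. (if t = i then \<Sum>a\<in>S. p a * f a else 1) * (if t = j then \<Sum>a\<in>S. p a * g a else 1))"
    using assms by (intro prod.cong refl) (auto simp: F_def sum1)
  also have "\<dots> = (\<Sum>a\<in>S. p a * f a) * (\<Sum>a\<in>S. p a * g a)"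
    using assms by (simp add: prod.distrib)
  finally show ?thesis .
qed

lemma sum_seq_prob_nth:
  assumes "i < n"
  shows "(\<Sum>xs\<in>nlists n S. seq_prob p xs * f (xs ! i)) = (\<Sum>a\<in>S. p a * f a)"
proof -
  define F where "F t a = p a * (if t = i then f a else 1)" for t a
  have "(\<Sum>xs\<in>nlists n S. seq_prob p xs * f (xs ! i)) = (\<Sum>xs\<in>nlists n S. \<Prod>t<n. F t (xs ! t))"
    using assms by (intro sum.cong refl) (simp add: F_def prod.distrib seq_prob_nlists)
  also have "\<dots> = (\<Prod>t<n. \<Sum>a\<in>S. F t a)"
    by (rule sum_nlists_prod[OF fin])
  also have "\<dots> = (\<Prod>t<n. (if t = i then \<Sum>a\<in>S. p a * f a else 1))"
    using assms by (intro prod.cong refl) (auto simp: F_def sum1)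
  also have "\<dots> = (\<Sum>a\<in>S. p a * f a)"
    using assms by simp
  finally show ?thesis .
qed

lemma sum_seq_prob_sum:
  "(\<Sum>xs\<in>nlists n S. seq_prob p xs * (\<Sum>i<n. f (xs ! i))) = real n * (\<Sum>a\<in>S. p a * f a)"
proof -
  have "(\<Sum>xs\<in>nlists n S. seq_prob p xs * (\<Sum>i<n. f (xs ! i)))
      = (\<Sum>i<n. \<Sum>xs\<in>nlists n S. seq_prob p xs * f (xs ! i))"
    unfolding sum_distrib_left by (rule sum.swap)
  then show ?thesis by (simp add: sum_seq_prob_nth)
qed

text \<open>The squared mean is counted on the diagonal too, which drops the subtracted term of the
  variance. Chebyshev uses the bound with mean zero, the second moment method uses it once for each
  codebook.\<close>

lemma sum_seq_prob_sum_squared: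
  "(\<Sum>xs\<in>nlists n S. seq_prob p xs * (\<Sum>i<n. f (xs ! i))\<^sup>2)
    \<le> real n * (\<Sum>a\<in>S. p a * (f a)\<^sup>2) + (real n * (\<Sum>a\<in>S. p a * f a))\<^sup>2"
proof -
  let ?m = "\<Sum>a\<in>S. p a * f a" and ?v = "\<Sum>a\<in>S. p a * (f a)\<^sup>2"
  have "(\<Sum>xs\<in>nlists n S. seq_prob p xs * (\<Sum>i<n. f (xs ! i))\<^sup>2)
      = (\<Sum>i<n. \<Sum>j<n. \<Sum>xs\<in>nlists n S. seq_prob p xs * (f (xs ! i) * f (xs ! j)))"
    unfolding power2_eq_square sum_product unfolding sum_distrib_left
    by (subst sum.swap, intro sum.cong refl, rule sum.swap)
  also have "\<dots> = (\<Sum>i<n. \<Sum>j<n. if i = j then ?v else ?m\<^sup>2)"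
    by (intro sum.cong refl)
       (auto simp: sum_seq_prob_nth2 sum_seq_prob_nth[where f = "\<lambda>a. f a * f a"] power2_eq_square)
  also have "\<dots> \<le> (\<Sum>i<n. \<Sum>j<n. (if i = j then ?v else 0) + ?m\<^sup>2)"
    by (intro sum_mono) auto
  also have "\<dots> = real n * ?v + (real n * ?m)\<^sup>2"
    by (simp add: sum.distrib power2_eq_square algebra_simps)
  finally show ?thesis .
qed

text \<open>One tail suffices because typicality will mean upper bounds on finitely many empirical
  averages, one for each inequality that the coding argument uses.\<close>

lemma chebyshev_upper:
  fixes f :: "'a \<Rightarrow> real"
  assumes "0 < \<delta>" "0 < n"
  defines "m \<equiv> (\<Sum>a\<in>S. p a * f a)"
  shows "(\<Sum>xs\<in>{xs\<in>nlists n S. real n * (m + \<delta>) < (\<Sum>i<n. f (xs ! i))}. seq_prob p xs)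
     \<le> (\<Sum>a\<in>S. p a * (f a - m)\<^sup>2) / (real n * \<delta>\<^sup>2)"
proof -
  let ?B = "{xs\<in>nlists n S. real n * (m + \<delta>) < (\<Sum>i<n. f (xs ! i))}"
  let ?Y = "\<lambda>xs. \<Sum>i<n. f (xs ! i) - m"
  have m0: "(\<Sum>a\<in>S. p a * (f a - m)) = 0"
    by (simp add: right_diff_distrib sum_subtractf m_def sum_distrib_right[symmetric] sum1)
  have "(\<Sum>xs\<in>?B. seq_prob p xs) * (real n * \<delta>)\<^sup>2 = (\<Sum>xs\<in>?B. seq_prob p xs * (real n * \<delta>)\<^sup>2)"
    by (rule sum_distrib_right)
  also have "\<dots> \<le> (\<Sum>xs\<in>?B. seq_prob p xs * (?Y xs)\<^sup>2)"
  proof (intro sum_mono mult_left_mono)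
    fix xs assume xs: "xs \<in> ?B"
    have "real n * \<delta> \<le> ?Y xs"
      using xs by (simp add: sum_subtractf algebra_simps)
    then show "(real n * \<delta>)\<^sup>2 \<le> (?Y xs)\<^sup>2"
      using assms by (intro power_mono) auto
    show "0 \<le> seq_prob p xs" using xs nonneg by (auto intro: seq_prob_nonneg)
  qed
  also have "\<dots> \<le> (\<Sum>xs\<in>nlists n S. seq_prob p xs * (?Y xs)\<^sup>2)"
    using nonneg by (intro sum_mono2) (auto simp: fin intro!: mult_nonneg_nonneg intro: seq_prob_nonneg)
  also have "\<dots> \<le> real n * (\<Sum>a\<in>S. p a * (f a - m)\<^sup>2)"
    using sum_seq_prob_sum_squared[of "\<lambda>a. f a - m" n] by (simp add: m0)
  finally show ?thesis
    using assms by (simp add: field_simps power2_eq_square)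
qed

end

text \<open>Second moment method: the number \<open>K\<close> of good pairs satisfies \<open>(E K)\<^sup>2 P(K = 0) \<le> Var K\<close>.\<close>
lemma no_good_pair_bound:
  fixes G :: "'a \<Rightarrow> 'b \<Rightarrow> bool"
  assumes A: "fin_dist A p" and B: "fin_dist B q"
    and \<alpha>: "\<And>a. a \<in> A \<Longrightarrow> (\<Sum>b\<in>B. q b * of_bool (G a b)) \<le> \<alpha>"
    and \<beta>: "\<And>b. b \<in> B \<Longrightarrow> (\<Sum>a\<in>A. p a * of_bool (G a b)) \<le> \<beta>"
    and P: "P = (\<Sum>a\<in>A. \<Sum>b\<in>B. p a * q b * of_bool (G a b))" "P > 0"
    and M: "M > 0" "N > 0"
  shows "(\<Sum>as\<in>nlists M A. \<Sum>bs\<in>nlists N B. seq_prob p as * seq_prob q bs *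
            of_bool (\<forall>i<M. \<forall>j<N. \<not> G (as ! i) (bs ! j)))
     \<le> (1 / (real M * real N) + \<alpha> / real M + \<beta> / real N) / P"
proof -
  interpret A: fin_dist A p by fact
  interpret B: fin_dist B q by fact
  define g where "g a b = (of_bool (G a b) :: real)" for a b
  have g2: "(g a b)\<^sup>2 = g a b" and g0: "0 \<le> g a b" for a b by (auto simp: g_def)
  note \<alpha> = \<alpha>[folded g_def] and \<beta> = \<beta>[folded g_def] and P = P[folded g_def]
  let ?pa = "\<lambda>a. \<Sum>b\<in>B. q b * g a b" and ?pb = "\<lambda>b. \<Sum>a\<in>A. p a * g a b"
  let ?w = "\<lambda>as bs. seq_prob p as * seq_prob q bs"
  let ?K = "\<lambda>as bs. \<Sum>j<N. \<Sum>i<M. g (as ! i) (bs ! j)"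
  let ?E = "\<lambda>F. \<Sum>as\<in>nlists M A. \<Sum>bs\<in>nlists N B. ?w as bs * F as bs"
  have wA: "0 \<le> seq_prob p as" if "as \<in> nlists M A" for as
    using that A.nonneg by (rule seq_prob_nonneg)
  have wB: "0 \<le> seq_prob q bs" if "bs \<in> nlists N B" for bs
    using that B.nonneg by (rule seq_prob_nonneg)
  have PA: "P = (\<Sum>a\<in>A. p a * ?pa a)"
    by (simp add: P sum_distrib_left mult.assoc)
  have PB: "P = (\<Sum>b\<in>B. q b * ?pb b)"
    unfolding P by (subst sum.swap) (simp add: sum_distrib_left mult_ac)
  have sq_a: "(\<Sum>a\<in>A. p a * (?pa a)\<^sup>2) \<le> \<alpha> * P"
  proof -
    have "(\<Sum>a\<in>A. p a * (?pa a)\<^sup>2) \<le> (\<Sum>a\<in>A. p a * (\<alpha> * ?pa a))"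
      unfolding power2_eq_square using A.nonneg B.nonneg \<alpha>
      by (intro sum_mono mult_left_mono mult_right_mono sum_nonneg mult_nonneg_nonneg) (auto simp: g0)
    then show ?thesis by (simp only: PA sum_distrib_left mult.left_commute)
  qed
  have sq_b: "(\<Sum>b\<in>B. q b * (?pb b)\<^sup>2) \<le> \<beta> * P"
  proof -
    have "(\<Sum>b\<in>B. q b * (?pb b)\<^sup>2) \<le> (\<Sum>b\<in>B. q b * (\<beta> * ?pb b))"
      unfolding power2_eq_square using A.nonneg B.nonneg \<beta>
      by (intro sum_mono mult_left_mono mult_right_mono sum_nonneg mult_nonneg_nonneg) (auto simp: g0)
    then show ?thesis by (simp only: PB sum_distrib_left mult.left_commute)
  qed
  have inner: "(\<Sum>b\<in>B. q b * (\<Sum>i<M. g (as ! i) b)) = (\<Sum>i<M. ?pa (as ! i))" for as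
    unfolding sum_distrib_left by (rule sum.swap)
  have E1: "?E ?K = real M * real N * P"
  proof -
    have "?E ?K = (\<Sum>as\<in>nlists M A. seq_prob p as * (real N * (\<Sum>i<M. ?pa (as ! i))))"
      using B.sum_seq_prob_sum[of "\<lambda>b. \<Sum>i<M. g (_ ! i) b" N]
      by (simp add: mult.assoc sum_distrib_left[symmetric] inner)
    also have "\<dots> = real N * (\<Sum>as\<in>nlists M A. seq_prob p as * (\<Sum>i<M. ?pa (as ! i)))"
      by (simp add: sum_distrib_left mult_ac)
    also have "\<dots> = real M * real N * P"
      by (simp add: A.sum_seq_prob_sum[of ?pa] PA)
    finally show ?thesis .
  qed
  \<comment> \<open>Expand the square over two pairs of codewords: a coinciding pair gives P, pairs
    that share only b give at most \<beta> P, pairs that share only a at most \<alpha> P, and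
    disjoint pairs P^2.\<close>
  have E2: "?E (\<lambda>as bs. (?K as bs)\<^sup>2)
      \<le> real N * real M * P + real N * (real M)\<^sup>2 * (\<beta> * P) + (real N)\<^sup>2 * real M * (\<alpha> * P) + (real M * real N * P)\<^sup>2"
  proof -
    have "?E (\<lambda>as bs. (?K as bs)\<^sup>2)
        = (\<Sum>as\<in>nlists M A. seq_prob p as * (\<Sum>bs\<in>nlists N B. seq_prob q bs * (?K as bs)\<^sup>2))"
      by (simp add: mult.assoc sum_distrib_left)
    also have "\<dots> \<le> (\<Sum>as\<in>nlists M A. seq_prob p as *
        (real N * (\<Sum>b\<in>B. q b * (\<Sum>i<M. g (as ! i) b)\<^sup>2) + (real N * (\<Sum>i<M. ?pa (as ! i)))\<^sup>2))"
      using B.sum_seq_prob_sum_squared[of "\<lambda>b. \<Sum>i<M. g (_ ! i) b" N]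
      by (intro sum_mono mult_left_mono wA) (auto simp: inner)
    also have "\<dots> = real N * (\<Sum>b\<in>B. q b * (\<Sum>as\<in>nlists M A. seq_prob p as * (\<Sum>i<M. g (as ! i) b)\<^sup>2))
        + (real N)\<^sup>2 * (\<Sum>as\<in>nlists M A. seq_prob p as * (\<Sum>i<M. ?pa (as ! i))\<^sup>2)"
    proof -
      have split: "(\<Sum>as\<in>nlists M A. w as * (k * X as + (k * Y as)\<^sup>2))
          = k * (\<Sum>as\<in>nlists M A. w as * X as) + k\<^sup>2 * (\<Sum>as\<in>nlists M A. w as * (Y as)\<^sup>2)"
        for w X Y :: "'a list \<Rightarrow> real" and k
        by (simp add: distrib_left sum.distrib sum_distrib_left power_mult_distrib mult_ac)
      have "(\<Sum>as\<in>nlists M A. seq_prob p as * (\<Sum>b\<in>B. q b * (\<Sum>i<M. g (as ! i) b)\<^sup>2))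
          = (\<Sum>b\<in>B. q b * (\<Sum>as\<in>nlists M A. seq_prob p as * (\<Sum>i<M. g (as ! i) b)\<^sup>2))"
        unfolding sum_distrib_left by (subst sum.swap) (simp add: mult.left_commute)
      then show ?thesis unfolding split by simp
    qed
    also have "\<dots> \<le> real N * (\<Sum>b\<in>B. q b * (real M * ?pb b + (real M * ?pb b)\<^sup>2))
        + (real N)\<^sup>2 * (real M * (\<alpha> * P) + (real M * P)\<^sup>2)"
    proof (intro add_mono mult_left_mono sum_mono)
      fix b assume "b \<in> B"
      show "(\<Sum>as\<in>nlists M A. seq_prob p as * (\<Sum>i<M. g (as ! i) b)\<^sup>2)
          \<le> real M * ?pb b + (real M * ?pb b)\<^sup>2"
        using A.sum_seq_prob_sum_squared[of "\<lambda>a. g a b" M]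
        by (simp add: g2)
      show "0 \<le> q b" using \<open>b \<in> B\<close> by (rule B.nonneg)
    next
      have "(\<Sum>as\<in>nlists M A. seq_prob p as * (\<Sum>i<M. ?pa (as ! i))\<^sup>2)
        \<le> real M * (\<Sum>a\<in>A. p a * (?pa a)\<^sup>2) + (real M * P)\<^sup>2"
        using A.sum_seq_prob_sum_squared[of ?pa M] by (simp add: PA)
      also have "\<dots> \<le> real M * (\<alpha> * P) + (real M * P)\<^sup>2"
        using sq_a by (intro add_mono mult_left_mono) auto
      finally show "(\<Sum>as\<in>nlists M A. seq_prob p as * (\<Sum>i<M. ?pa (as ! i))\<^sup>2)
        \<le> real M * (\<alpha> * P) + (real M * P)\<^sup>2" .
    qed auto
    also have "(\<Sum>b\<in>B. q b * (real M * ?pb b + (real M * ?pb b)\<^sup>2))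
        = real M * P + (real M)\<^sup>2 * (\<Sum>b\<in>B. q b * (?pb b)\<^sup>2)"
    proof -
      have "(\<Sum>b\<in>B. q b * (k * Y b + (k * Y b)\<^sup>2)) = k * (\<Sum>b\<in>B. q b * Y b) + k\<^sup>2 * (\<Sum>b\<in>B. q b * (Y b)\<^sup>2)"
        for Y k
        by (simp add: distrib_left sum.distrib sum_distrib_left power_mult_distrib mult_ac)
      then show ?thesis unfolding PB by simp
    qed
    also have "real N * (real M * P + (real M)\<^sup>2 * (\<Sum>b\<in>B. q b * (?pb b)\<^sup>2))
        \<le> real N * (real M * P + (real M)\<^sup>2 * (\<beta> * P))"
      using sq_b by (intro mult_left_mono add_mono) auto
    finally show ?thesis
      by (simp add: algebra_simps power2_eq_square)
  qed
  let ?m = "real M * real N * P"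
  have tot: "?E (\<lambda>_ _. 1) = 1"
    by (simp add: sum_distrib_left[symmetric] B.sum_seq_prob A.sum_seq_prob)
  have "?E (\<lambda>as bs. of_bool (\<forall>i<M. \<forall>j<N. \<not> G (as ! i) (bs ! j))) * ?m\<^sup>2
      = ?E (\<lambda>as bs. of_bool (\<forall>i<M. \<forall>j<N. \<not> G (as ! i) (bs ! j)) * ?m\<^sup>2)"
    by (simp add: sum_distrib_right mult.assoc)
  also have "\<dots> \<le> ?E (\<lambda>as bs. (?K as bs - ?m)\<^sup>2)"
  proof (intro sum_mono mult_left_mono mult_nonneg_nonneg wA wB)
    fix as bs
    show "of_bool (\<forall>i<M. \<forall>j<N. \<not> G (as ! i) (bs ! j)) * ?m\<^sup>2 \<le> (?K as bs - ?m)\<^sup>2"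
    proof (cases "\<forall>i<M. \<forall>j<N. \<not> G (as ! i) (bs ! j)")
      case True
      then have "?K as bs = 0" by (intro sum.neutral ballI) (auto simp: g_def)
      then show ?thesis by simp
    qed auto
  qed auto
  also have "\<dots> = ?E (\<lambda>as bs. (?K as bs)\<^sup>2) - 2 * ?m * ?E ?K + ?m\<^sup>2 * ?E (\<lambda>_ _. 1)"
    by (simp add: power2_diff distrib_left right_diff_distrib sum.distrib sum_subtractf
        sum_distrib_left mult_ac)
  also have "\<dots> \<le> real N * real M * P + real N * (real M)\<^sup>2 * (\<beta> * P) + (real N)\<^sup>2 * real M * (\<alpha> * P)"
    using E2 unfolding E1 tot by (simp add: power2_eq_square mult_ac)
  finally have "?E (\<lambda>as bs. of_bool (\<forall>i<M. \<forall>j<N. \<not> G (as ! i) (bs ! j)))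
      \<le> (real N * real M * P + real N * (real M)\<^sup>2 * (\<beta> * P) + (real N)\<^sup>2 * real M * (\<alpha> * P)) / ?m\<^sup>2"
    using M P(2) by (simp add: pos_le_divide_eq)
  also have "\<dots> = (1 / (real M * real N) + \<alpha> / real M + \<beta> / real N) / P"
    using M P(2) by (simp add: field_simps power2_eq_square)
  finally show ?thesis .
qed

section \<open>Random codebooks\<close>

lemma (in fin_dist) exists_le_average:
  assumes "(\<Sum>a\<in>S. p a * f a) \<le> (c::real)"
  shows "\<exists>a\<in>S. f a \<le> c"
proof (rule ccontr)
  assume "\<not> ?thesis"
  then have gt: "\<And>a. a \<in> S \<Longrightarrow> c < f a" by force
  obtain a where a: "a \<in> S" "p a > 0"
    using sum1 nonneg by (metis less_eq_real_def sum.neutral zero_neq_one)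
  have "(\<Sum>a\<in>S. p a * c) < (\<Sum>a\<in>S. p a * f a)"
  proof (rule sum_strict_mono_ex1[OF fin])
    show "\<forall>x\<in>S. p x * c \<le> p x * f x"
      using nonneg gt by (auto intro!: mult_left_mono dest: less_imp_le)
    show "\<exists>x\<in>S. p x * c < p x * f x"
      using a gt[of a] by (intro bexI[of _ a]) auto
  qed
  then show False
    using assms by (simp add: sum_distrib_right[symmetric] sum1)
qed

lemma (in fin_dist) average_le:
  assumes "\<And>a. a \<in> S \<Longrightarrow> f a \<le> (c::real)"
  shows "(\<Sum>a\<in>S. p a * f a) \<le> c"
proof -
  have "(\<Sum>a\<in>S. p a * f a) \<le> (\<Sum>a\<in>S. p a * c)"
    using assms nonneg by (intro sum_mono mult_left_mono)
  then show ?thesis by (simp add: sum_distrib_right[symmetric] sum1)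
qed

lemma sum_rotate:
  "(\<Sum>a\<in>A. \<Sum>b\<in>B. \<Sum>c\<in>C. f a b c) = (\<Sum>c\<in>C. \<Sum>a\<in>A. \<Sum>b\<in>B. f a b c)"
proof -
  have "(\<Sum>a\<in>A. \<Sum>b\<in>B. \<Sum>c\<in>C. f a b c) = (\<Sum>a\<in>A. \<Sum>c\<in>C. \<Sum>b\<in>B. f a b c)"
    by (intro sum.cong refl sum.swap)
  also have "\<dots> = (\<Sum>c\<in>C. \<Sum>a\<in>A. \<Sum>b\<in>B. f a b c)"
    by (rule sum.swap)
  finally show ?thesis .
qed

text \<open>Here \<open>r\<close> and \<open>v\<close> are the channels from one codeword alone to the source, and \<open>G\<close> is
  any set of typical triples; the bounds on \<open>G\<close> replace the usual estimates of type class sizes.\<close>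
lemma random_codebooks:
  fixes pA :: "'a::finite \<Rightarrow> real" and pU :: "'u::finite \<Rightarrow> real"
    and W :: "'a \<Rightarrow> 'u \<Rightarrow> 'x::finite \<Rightarrow> real" and G :: "'x list \<Rightarrow> 'a list \<Rightarrow> 'u list \<Rightarrow> bool"
    and n M N :: nat and \<eta> L0 L1 L2 :: real
  assumes A: "fin_dist UNIV pA" and U: "fin_dist UNIV pU" and W: "\<And>a u x. 0 < W a u x"
    and W1: "\<And>a u. (\<Sum>x\<in>UNIV. W a u x) = 1"
    and r_def: "\<And>a x. r a x = (\<Sum>u\<in>UNIV. pU u * W a u x)"
    and v_def: "\<And>u x. v u x = (\<Sum>a\<in>UNIV. pA a * W a u x)"
    and px_def: "\<And>x. px x = (\<Sum>a\<in>UNIV. \<Sum>u\<in>UNIV. pA a * (pU u * W a u x))"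
    and L: "0 < L0" "0 \<le> L1" "0 \<le> L2"
    and G0: "\<And>x a u. x \<in> nlists n UNIV \<Longrightarrow> a \<in> nlists n UNIV \<Longrightarrow> u \<in> nlists n UNIV \<Longrightarrow> G x a u \<Longrightarrow>
        (\<Prod>t<n. W (a!t) (u!t) (x!t)) \<le> L0 * (\<Prod>t<n. px (x!t))"
    and G1: "\<And>x a u. x \<in> nlists n UNIV \<Longrightarrow> a \<in> nlists n UNIV \<Longrightarrow> u \<in> nlists n UNIV \<Longrightarrow> G x a u \<Longrightarrow>
        (\<Prod>t<n. r (a!t) (x!t)) \<le> L1 * (\<Prod>t<n. W (a!t) (u!t) (x!t))"
    and G2: "\<And>x a u. x \<in> nlists n UNIV \<Longrightarrow> a \<in> nlists n UNIV \<Longrightarrow> u \<in> nlists n UNIV \<Longrightarrow> G x a u \<Longrightarrow>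
        (\<Prod>t<n. v (u!t) (x!t)) \<le> L2 * (\<Prod>t<n. W (a!t) (u!t) (x!t))"
    and \<eta>: "(\<Sum>x\<in>nlists n UNIV. \<Sum>a\<in>nlists n UNIV. \<Sum>u\<in>nlists n UNIV.
        seq_prob pA a * seq_prob pU u * (\<Prod>t<n. W (a!t) (u!t) (x!t)) * of_bool (\<not> G x a u)) \<le> \<eta>"
    and MN: "M > 0" "N > 0"
  shows "\<exists>as\<in>nlists M (nlists n UNIV). \<exists>us\<in>nlists N (nlists n UNIV).
     (\<Sum>x\<in>nlists n UNIV. seq_prob px x * of_bool (\<forall>i<M. \<forall>j<N. \<not> G x (as ! i) (us ! j)))
       \<le> 2 * \<eta> + 2 * L0 * (1 / (real M * real N) + L1 / real M + L2 / real N)"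
proof -
  interpret A: fin_dist UNIV pA by fact
  interpret U: fin_dist UNIV pU by fact
  let ?SX = "nlists n (UNIV :: 'x set)" and ?SA = "nlists n (UNIV :: 'a set)" and ?SU = "nlists n (UNIV :: 'u set)"
  let ?qA = "seq_prob pA" and ?qU = "seq_prob pU" and ?P = "seq_prob px"
  define Ws where "Ws a u x = (\<Prod>t<n. W (a!t) (u!t) (x!t))" for a u x
  define T where "T = 1 / (real M * real N) + L1 / real M + L2 / real N"
  interpret SA: fin_dist ?SA ?qA by (rule A.fin_dist_nlists)
  interpret SU: fin_dist ?SU ?qU by (rule U.fin_dist_nlists)
  interpret CA: fin_dist "nlists M ?SA" "seq_prob ?qA" by (rule SA.fin_dist_nlists)
  interpret CU: fin_dist "nlists N ?SU" "seq_prob ?qU" by (rule SU.fin_dist_nlists)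
  have Wpos: "0 < Ws a u x" for a u x
    unfolding Ws_def by (intro prod_pos) (use W in auto)
  have sumU: "(\<Sum>u\<in>?SU. ?qU u * Ws a u x) = (\<Prod>t<n. r (a!t) (x!t))" for a x
  proof -
    have "(\<Sum>u\<in>?SU. ?qU u * Ws a u x) = (\<Sum>u\<in>?SU. \<Prod>t<n. pU (u!t) * W (a!t) (u!t) (x!t))"
      by (intro sum.cong refl) (simp add: seq_prob_nlists Ws_def prod.distrib)
    also have "\<dots> = (\<Prod>t<n. r (a!t) (x!t))"
      unfolding r_def using sum_nlists_prod[where F = "\<lambda>t b. pU b * W (a!t) b (x!t)"] by simp
    finally show ?thesis .
  qed
  have sumA: "(\<Sum>a\<in>?SA. ?qA a * Ws a u x) = (\<Prod>t<n. v (u!t) (x!t))" for u x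
  proof -
    have "(\<Sum>a\<in>?SA. ?qA a * Ws a u x) = (\<Sum>a\<in>?SA. \<Prod>t<n. pA (a!t) * W (a!t) (u!t) (x!t))"
      by (intro sum.cong refl) (simp add: seq_prob_nlists Ws_def prod.distrib)
    also have "\<dots> = (\<Prod>t<n. v (u!t) (x!t))"
      unfolding v_def using sum_nlists_prod[where F = "\<lambda>t b. pA b * W b (u!t) (x!t)"] by simp
    finally show ?thesis .
  qed
  have sumAU: "(\<Sum>a\<in>?SA. \<Sum>u\<in>?SU. ?qA a * ?qU u * Ws a u x) = ?P x" if "x \<in> ?SX" for x
  proof -
    have "(\<Sum>a\<in>?SA. \<Sum>u\<in>?SU. ?qA a * ?qU u * Ws a u x) = (\<Sum>a\<in>?SA. ?qA a * (\<Prod>t<n. r (a!t) (x!t)))"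
      by (simp add: sumU[symmetric] sum_distrib_left mult.assoc)
    also have "\<dots> = (\<Sum>a\<in>?SA. \<Prod>t<n. pA (a!t) * r (a!t) (x!t))"
      by (intro sum.cong refl) (simp add: seq_prob_nlists prod.distrib)
    also have "\<dots> = (\<Prod>t<n. px (x!t))"
      unfolding px_def using sum_nlists_prod[where F = "\<lambda>t b. pA b * r b (x!t)"]
      by (simp add: r_def sum_distrib_left)
    also have "\<dots> = ?P x" using that by (simp add: seq_prob_nlists)
    finally show ?thesis .
  qed
  \<comment> \<open>\<open>\<omega> x\<close> and \<open>\<omega>' x\<close> split the probability
    of x into the parts carried by typical and by atypical triples of the joint law.\<close>
  define \<omega> where "\<omega> x = (\<Sum>a\<in>?SA. \<Sum>u\<in>?SU. ?qA a * ?qU u * Ws a u x * of_bool (G x a u))" for x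
  define \<omega>' where "\<omega>' x = (\<Sum>a\<in>?SA. \<Sum>u\<in>?SU. ?qA a * ?qU u * Ws a u x * of_bool (\<not> G x a u))" for x
  have \<omega>_sum: "\<omega> x + \<omega>' x = ?P x" if "x \<in> ?SX" for x
    unfolding \<omega>_def \<omega>'_def sumAU[OF that, symmetric]
    unfolding sum.distrib[symmetric] by (intro sum.cong refl) simp
  have \<omega>'_nonneg: "0 \<le> \<omega>' x" for x
    unfolding \<omega>'_def using SA.nonneg SU.nonneg Wpos
    by (intro sum_nonneg mult_nonneg_nonneg) (auto intro: less_imp_le)
  have px_nonneg: "0 \<le> px x" for x
    unfolding px_def using A.nonneg U.nonneg W by (intro sum_nonneg mult_nonneg_nonneg) (auto intro: less_imp_le)
  have P_nonneg: "0 \<le> ?P x" if "x \<in> ?SX" for x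
    using that by (rule seq_prob_nonneg) (rule px_nonneg)
  have "(\<Sum>x\<in>UNIV. px x) = (\<Sum>a\<in>UNIV. \<Sum>u\<in>UNIV. \<Sum>x\<in>UNIV. pA a * (pU u * W a u x))"
    unfolding px_def by (subst sum.swap, intro sum.cong refl, rule sum.swap)
  also have "\<dots> = 1"
    by (simp add: sum_distrib_left[symmetric] W1 U.sum1 A.sum1)
  finally interpret X: fin_dist UNIV px
    using px_nonneg by unfold_locales auto
  interpret SX: fin_dist ?SX ?P by (rule X.fin_dist_nlists)
  have T: "0 \<le> T" unfolding T_def using L by simp
  define B where "B x = (\<Sum>as\<in>nlists M ?SA. \<Sum>us\<in>nlists N ?SU. seq_prob ?qA as * seq_prob ?qU us *
            of_bool (\<forall>i<M. \<forall>j<N. \<not> G x (as ! i) (us ! j)))" for x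
  have B1: "B x \<le> 1" for x
    unfolding B_def mult.assoc sum_distrib_left[symmetric]
    by (intro CA.average_le CU.average_le) auto
  \<comment> \<open>If typical triples carry at least half of the probability of x, the second
    moment bound applies; otherwise that probability is at most \<open>2 * \<omega>' x\<close>,
    which pays for x entirely. The factors 2 in the conclusion come from this split.\<close>
  have key: "?P x * B x \<le> 2 * \<omega>' x + 2 * L0 * T * ?P x" if x: "x \<in> ?SX" for x
  proof (cases "\<omega> x \<ge> ?P x / 2 \<and> ?P x > 0")
    case True
    define Q where "Q = (\<Sum>a\<in>?SA. \<Sum>u\<in>?SU. ?qA a * ?qU u * of_bool (G x a u))"
    \<comment> \<open>Change of measure: on G the joint law exceeds the product of source and
      codeword laws by at most the factor \<open>L0\<close>, so a pair of independent codewords is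
      good with probability at least 1 / (2 L0).\<close>
    have "?P x / 2 \<le> \<omega> x" using True by simp
    also have "\<omega> x \<le> (\<Sum>a\<in>?SA. \<Sum>u\<in>?SU. L0 * ?P x * (?qA a * ?qU u * of_bool (G x a u)))"
      unfolding \<omega>_def
    proof (intro sum_mono)
      fix a u assume au: "a \<in> ?SA" "u \<in> ?SU"
      show "?qA a * ?qU u * Ws a u x * of_bool (G x a u) \<le> L0 * ?P x * (?qA a * ?qU u * of_bool (G x a u))"
      proof (cases "G x a u")
        case True
        have "Ws a u x \<le> L0 * ?P x"
          using G0[OF x au True] x by (simp add: Ws_def seq_prob_nlists)
        then have "(?qA a * ?qU u) * Ws a u x \<le> (?qA a * ?qU u) * (L0 * ?P x)"
          using SA.nonneg SU.nonneg au by (intro mult_left_mono mult_nonneg_nonneg)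
        then show ?thesis using True by (simp add: mult_ac)
      qed simp
    qed
    also have "\<dots> = L0 * ?P x * Q"
      unfolding Q_def by (simp only: sum_distrib_left)
    finally have Q: "1 / (2 * L0) \<le> Q"
      using True L by (simp add: field_simps)
    then have Qpos: "0 < Q" using L by (smt (verit) divide_pos_pos zero_less_mult_iff)
    have "B x \<le> T / Q"
      unfolding B_def T_def
    proof (rule no_good_pair_bound[OF SA.fin_dist_axioms SU.fin_dist_axioms _ _ Q_def Qpos MN])
      fix a assume a: "a \<in> ?SA"
      \<comment> \<open>Bayes: dividing \<open>?qU u * Ws a u x\<close> by the product of the
        \<open>r\<close> gives the posterior of u. By \<open>G1\<close> the prior of a good u is at
        most \<open>L1\<close> times its posterior, and posteriors sum to one.\<close>
      have "(\<Sum>u\<in>?SU. ?qU u * of_bool (G x a u)) * (\<Prod>t<n. r (a!t) (x!t))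
          = (\<Sum>u\<in>?SU. ?qU u * of_bool (G x a u) * (\<Prod>t<n. r (a!t) (x!t)))"
        by (rule sum_distrib_right)
      also have "\<dots> \<le> (\<Sum>u\<in>?SU. L1 * (?qU u * Ws a u x))"
      proof (intro sum_mono)
        fix u assume u: "u \<in> ?SU"
        show "?qU u * of_bool (G x a u) * (\<Prod>t<n. r (a!t) (x!t)) \<le> L1 * (?qU u * Ws a u x)"
        proof (cases "G x a u")
          case True
          have "?qU u * (\<Prod>t<n. r (a!t) (x!t)) \<le> ?qU u * (L1 * Ws a u x)"
            using G1[OF x a u True] SU.nonneg[OF u] unfolding Ws_def by (intro mult_left_mono)
          then show ?thesis using True by (simp add: mult_ac)
        next
          case False
          then show ?thesis using L SU.nonneg[OF u] Wpos[of a u x] by simp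
        qed
      qed
      also have "\<dots> = L1 * (\<Prod>t<n. r (a!t) (x!t))"
        by (simp add: sum_distrib_left[symmetric] sumU)
      finally show "(\<Sum>u\<in>?SU. ?qU u * of_bool (G x a u)) \<le> L1"
      proof (rule mult_right_le_imp_le)
        have "0 < r a x" for a x
        proof -
          obtain u where "pU u > 0"
            using U.sum1 U.nonneg by (metis iso_tuple_UNIV_I less_eq_real_def sum.neutral zero_neq_one)
          then show ?thesis unfolding r_def
            by (intro sum_pos2[of _ u]) (use \<open>pU u > 0\<close> U.nonneg W in \<open>auto simp: less_imp_le\<close>)
        qed
        then show "0 < (\<Prod>t<n. r (a!t) (x!t))" by (intro prod_pos) auto
      qed
    next
      fix u assume u: "u \<in> ?SU"
      have "(\<Sum>a\<in>?SA. ?qA a * of_bool (G x a u)) * (\<Prod>t<n. v (u!t) (x!t))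
          = (\<Sum>a\<in>?SA. ?qA a * of_bool (G x a u) * (\<Prod>t<n. v (u!t) (x!t)))"
        by (rule sum_distrib_right)
      also have "\<dots> \<le> (\<Sum>a\<in>?SA. L2 * (?qA a * Ws a u x))"
      proof (intro sum_mono)
        fix a assume a: "a \<in> ?SA"
        show "?qA a * of_bool (G x a u) * (\<Prod>t<n. v (u!t) (x!t)) \<le> L2 * (?qA a * Ws a u x)"
        proof (cases "G x a u")
          case True
          have "?qA a * (\<Prod>t<n. v (u!t) (x!t)) \<le> ?qA a * (L2 * Ws a u x)"
            using G2[OF x a u True] SA.nonneg[OF a] unfolding Ws_def by (intro mult_left_mono)
          then show ?thesis using True by (simp add: mult_ac)
        next
          case False
          then show ?thesis using L SA.nonneg[OF a] Wpos[of a u x] by simp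
        qed
      qed
      also have "\<dots> = L2 * (\<Prod>t<n. v (u!t) (x!t))"
        by (simp add: sum_distrib_left[symmetric] sumA)
      finally show "(\<Sum>a\<in>?SA. ?qA a * of_bool (G x a u)) \<le> L2"
      proof (rule mult_right_le_imp_le)
        have "0 < v u x" for u x
        proof -
          obtain a where "pA a > 0"
            using A.sum1 A.nonneg by (metis iso_tuple_UNIV_I less_eq_real_def sum.neutral zero_neq_one)
          then show ?thesis unfolding v_def
            by (intro sum_pos2[of _ a]) (use \<open>pA a > 0\<close> A.nonneg W in \<open>auto simp: less_imp_le\<close>)
        qed
        then show "0 < (\<Prod>t<n. v (u!t) (x!t))" by (intro prod_pos) auto
      qed
    qed
    also have "\<dots> \<le> 2 * L0 * T"
    proof -
      have "T * (1 / (2 * L0)) \<le> T * Q" using Q T by (intro mult_left_mono)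
      then show ?thesis using L Qpos by (simp add: field_simps)
    qed
    finally have "?P x * B x \<le> ?P x * (2 * L0 * T)"
      using P_nonneg[OF x] by (intro mult_left_mono)
    then show ?thesis using \<omega>'_nonneg[of x] by (simp add: mult_ac)
  next
    case False
    then have "?P x \<le> 2 * \<omega>' x"
      using \<omega>_sum[OF x] \<omega>'_nonneg[of x] P_nonneg[OF x] by force
    moreover have "?P x * B x \<le> ?P x" using B1[of x] P_nonneg[OF x] by (simp add: mult_left_le)
    moreover have "0 \<le> 2 * L0 * T * ?P x" using L T P_nonneg[OF x] by simp
    ultimately show ?thesis by linarith
  qed
  have "(\<Sum>as\<in>nlists M ?SA. seq_prob ?qA as * (\<Sum>us\<in>nlists N ?SU. seq_prob ?qU us *
      (\<Sum>x\<in>?SX. ?P x * of_bool (\<forall>i<M. \<forall>j<N. \<not> G x (as ! i) (us ! j))))) = (\<Sum>x\<in>?SX. ?P x * B x)"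
    unfolding B_def sum_distrib_left by (subst sum_rotate) (simp add: mult_ac)
  also have "\<dots> \<le> (\<Sum>x\<in>?SX. 2 * \<omega>' x + 2 * L0 * T * ?P x)"
    by (intro sum_mono key)
  also have "\<dots> = 2 * (\<Sum>x\<in>?SX. \<omega>' x) + 2 * L0 * T * (\<Sum>x\<in>?SX. ?P x)"
    by (simp add: sum.distrib sum_distrib_left)
  also have "\<dots> \<le> 2 * \<eta> + 2 * L0 * T"
    using \<eta> by (simp add: SX.sum1 \<omega>'_def Ws_def)
  finally have "\<exists>as\<in>nlists M ?SA. (\<Sum>us\<in>nlists N ?SU. seq_prob ?qU us *
      (\<Sum>x\<in>?SX. ?P x * of_bool (\<forall>i<M. \<forall>j<N. \<not> G x (as ! i) (us ! j)))) \<le> 2 * \<eta> + 2 * L0 * T"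
    by (rule CA.exists_le_average)
  then obtain as where as: "as \<in> nlists M ?SA"
    and "(\<Sum>us\<in>nlists N ?SU. seq_prob ?qU us *
      (\<Sum>x\<in>?SX. ?P x * of_bool (\<forall>i<M. \<forall>j<N. \<not> G x (as ! i) (us ! j)))) \<le> 2 * \<eta> + 2 * L0 * T"
    by blast
  from CU.exists_le_average[OF this(2)] as show ?thesis
    unfolding T_def[symmetric] by blast
qed

text \<open>A union bound over the statistics, with Chebyshev for each. Zipping the three sequences
  makes them one i.i.d. sequence with law \<open>J\<close>, and the variances do not depend on n,
  hence the decay like 1 / n.\<close>

lemma atypical_prob_le:
  fixes pA :: "'a::finite \<Rightarrow> real" and pU :: "'u::finite \<Rightarrow> real"
    and W :: "'a \<Rightarrow> 'u \<Rightarrow> 'x::finite \<Rightarrow> real" and \<Phi> :: "('x \<times> 'a \<times> 'u \<Rightarrow> real) set"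
  assumes A: "fin_dist UNIV pA" and U: "fin_dist UNIV pU" and W: "\<And>a u x. 0 < W a u x"
    and W1: "\<And>a u. (\<Sum>x\<in>UNIV. W a u x) = 1"
    and "finite \<Phi>" "0 < \<delta>" "0 < n"
  defines "J \<equiv> \<lambda>(x, a, u). pA a * pU u * W a u x"
  defines "\<mu> \<equiv> \<lambda>\<phi>. \<Sum>z\<in>UNIV. J z * \<phi> z"
  shows "(\<Sum>x\<in>nlists n UNIV. \<Sum>a\<in>nlists n UNIV. \<Sum>u\<in>nlists n UNIV.
        seq_prob pA a * seq_prob pU u * (\<Prod>t<n. W (a!t) (u!t) (x!t)) *
        of_bool (\<not> (\<forall>\<phi>\<in>\<Phi>. (\<Sum>t<n. \<phi> (x!t, a!t, u!t)) \<le> real n * (\<mu> \<phi> + \<delta>))))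
    \<le> (\<Sum>\<phi>\<in>\<Phi>. \<Sum>z\<in>UNIV. J z * (\<phi> z - \<mu> \<phi>)\<^sup>2) / \<delta>\<^sup>2 / real n"
proof -
  interpret A: fin_dist UNIV pA by fact
  interpret U: fin_dist UNIV pU by fact
  have "(\<Sum>z\<in>UNIV. J z) = (\<Sum>x\<in>UNIV. \<Sum>a\<in>UNIV. \<Sum>u\<in>UNIV. pA a * pU u * W a u x)"
    by (simp add: J_def sum.cartesian_product UNIV_Times_UNIV[symmetric] del: UNIV_Times_UNIV)
  also have "\<dots> = (\<Sum>a\<in>UNIV. \<Sum>u\<in>UNIV. \<Sum>x\<in>UNIV. pA a * pU u * W a u x)"
    by (rule sum_rotate[symmetric])
  also have "\<dots> = 1"
    by (simp add: sum_distrib_left[symmetric] W1 U.sum1 A.sum1)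
  finally interpret J: fin_dist UNIV J
    using A.nonneg U.nonneg W by unfold_locales (auto simp: J_def less_imp_le split: prod.splits)
  let ?S = "nlists n (UNIV :: ('x \<times> 'a \<times> 'u) set)"
  let ?bad = "\<lambda>\<phi> zs. real n * (\<mu> \<phi> + \<delta>) < (\<Sum>t<n. \<phi> (zs ! t))"
  have J_zip: "seq_prob J (zip x (zip a u)) = seq_prob pA a * seq_prob pU u * (\<Prod>t<n. W (a!t) (u!t) (x!t))"
    if "x \<in> nlists n UNIV" "a \<in> nlists n UNIV" "u \<in> nlists n UNIV" for x a u
    using that by (simp add: seq_prob_def J_def prod.distrib)
  have "(\<Sum>x\<in>nlists n UNIV. \<Sum>a\<in>nlists n UNIV. \<Sum>u\<in>nlists n UNIV.
        seq_prob pA a * seq_prob pU u * (\<Prod>t<n. W (a!t) (u!t) (x!t)) *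
        of_bool (\<not> (\<forall>\<phi>\<in>\<Phi>. (\<Sum>t<n. \<phi> (x!t, a!t, u!t)) \<le> real n * (\<mu> \<phi> + \<delta>))))
      = (\<Sum>x\<in>nlists n UNIV. \<Sum>a\<in>nlists n UNIV. \<Sum>u\<in>nlists n UNIV.
        seq_prob J (zip x (zip a u)) * of_bool (\<exists>\<phi>\<in>\<Phi>. ?bad \<phi> (zip x (zip a u))))"
    by (intro sum.cong refl) (simp add: J_zip not_le)
  also have "\<dots> = (\<Sum>zs\<in>?S. seq_prob J zs * of_bool (\<exists>\<phi>\<in>\<Phi>. ?bad \<phi> zs))"
    unfolding UNIV_Times_UNIV[symmetric] sum_nlists_zip ..
  also have "\<dots> \<le> (\<Sum>zs\<in>?S. \<Sum>\<phi>\<in>\<Phi>. seq_prob J zs * of_bool (?bad \<phi> zs))"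
    unfolding sum_distrib_left[symmetric]
  proof (intro sum_mono mult_left_mono)
    fix zs assume zs: "zs \<in> ?S"
    show "0 \<le> seq_prob J zs" using zs J.nonneg by (rule seq_prob_nonneg)
    show "of_bool (\<exists>\<phi>\<in>\<Phi>. ?bad \<phi> zs) \<le> (\<Sum>\<phi>\<in>\<Phi>. of_bool (?bad \<phi> zs) :: real)"
    proof (cases "\<exists>\<phi>\<in>\<Phi>. ?bad \<phi> zs")
      case True
      then obtain \<phi> where "\<phi> \<in> \<Phi>" "?bad \<phi> zs" by blast
      then show ?thesis
        using member_le_sum[of \<phi> \<Phi> "\<lambda>\<phi>. of_bool (?bad \<phi> zs) :: real"] \<open>finite \<Phi>\<close> True
        by (simp del: sum_of_bool_eq)
    qed (simp add: sum_nonneg del: sum_of_bool_eq)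
  qed
  also have "\<dots> = (\<Sum>\<phi>\<in>\<Phi>. \<Sum>zs\<in>{zs\<in>?S. ?bad \<phi> zs}. seq_prob J zs)"
    by (subst sum.swap, intro sum.cong refl sum.mono_neutral_cong_right) auto
  also have "\<dots> \<le> (\<Sum>\<phi>\<in>\<Phi>. (\<Sum>z\<in>UNIV. J z * (\<phi> z - \<mu> \<phi>)\<^sup>2) / (real n * \<delta>\<^sup>2))"
    unfolding \<mu>_def using assms(6,7) by (intro sum_mono J.chebyshev_upper)
  also have "\<dots> = (\<Sum>\<phi>\<in>\<Phi>. \<Sum>z\<in>UNIV. J z * (\<phi> z - \<mu> \<phi>)\<^sup>2) / \<delta>\<^sup>2 / real n"
    by (simp add: sum_divide_distrib mult.commute)
  finally show ?thesis .
qed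

section \<open>Coding theorem for independent descriptions\<close>

lemma prod_le_exp_mult_prod:
  fixes f g :: "nat \<Rightarrow> real"
  assumes "\<And>t. t < n \<Longrightarrow> 0 < f t" "\<And>t. t < n \<Longrightarrow> 0 < g t" "(\<Sum>t<n. ln (f t / g t)) \<le> c"
  shows "(\<Prod>t<n. f t) \<le> exp c * (\<Prod>t<n. g t)"
proof -
  have "(\<Prod>t<n. f t) = (\<Prod>t<n. f t / g t) * (\<Prod>t<n. g t)"
    unfolding prod.distrib[symmetric] using assms by (intro prod.cong refl) (auto simp: less_imp_neq[symmetric])
  also have "(\<Prod>t<n. f t / g t) = exp (\<Sum>t<n. ln (f t / g t))"
    unfolding exp_sum[OF finite_lessThan] using assms by (intro prod.cong refl) auto
  also have "exp (\<Sum>t<n. ln (f t / g t)) * (\<Prod>t<n. g t) \<le> exp c * (\<Prod>t<n. g t)"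
    using assms by (intro mult_right_mono prod_nonneg) (auto intro: less_imp_le)
  finally show ?thesis .
qed

text \<open>The part of the El Gamal--Cover region that belongs to independent descriptions \<open>a\<close> and \<open>u\<close>;
  \<open>R1\<close> and \<open>R2\<close> are in nats.\<close>
lemma independent_descriptions_achievable:
  fixes pA :: "'a::finite \<Rightarrow> real" and pU :: "'u::finite \<Rightarrow> real"
    and W :: "'a \<Rightarrow> 'u \<Rightarrow> 'x::finite \<Rightarrow> real" and d :: "'x \<Rightarrow> 'y \<Rightarrow> real"
    and \<psi>1 :: "'a \<Rightarrow> 'y" and \<psi>2 :: "'u \<Rightarrow> 'y" and \<psi>12 :: "'a \<Rightarrow> 'u \<Rightarrow> 'y"
  assumes A: "fin_dist UNIV pA" and U: "fin_dist UNIV pU" and W: "\<And>a u x. 0 < W a u x"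
    and W1: "\<And>a u. (\<Sum>x\<in>UNIV. W a u x) = 1"
    and d: "\<And>x y. 0 \<le> d x y" "\<And>x y. d x y \<le> B"
    and r_def: "\<And>a x. r a x = (\<Sum>u\<in>UNIV. pU u * W a u x)"
    and v_def: "\<And>u x. v u x = (\<Sum>a\<in>UNIV. pA a * W a u x)"
    and px_def: "\<And>x. px x = (\<Sum>a\<in>UNIV. \<Sum>u\<in>UNIV. pA a * (pU u * W a u x))"
    and E_def: "\<And>\<phi>. E \<phi> = (\<Sum>(x, a, u)\<in>UNIV. pA a * pU u * W a u x * \<phi> x a u)"
    and R: "0 \<le> R1" "0 \<le> R2"
    and R1: "E (\<lambda>x a u. ln (r a x / px x)) < R1"
    and R2: "E (\<lambda>x a u. ln (v u x / px x)) < R2"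
    and R12: "E (\<lambda>x a u. ln (W a u x / px x)) < R1 + R2"
  shows "md_achievable px d (R1 / ln 2) (R2 / ln 2)
    (ereal (E (\<lambda>x a u. d x (\<psi>1 a)))) (ereal (E (\<lambda>x a u. d x (\<psi>2 u)))) (ereal (E (\<lambda>x a u. d x (\<psi>12 a u))))"
  unfolding md_achievable_def
proof (intro allI impI)
  fix eps :: real assume eps: "0 < eps"
  interpret A: fin_dist UNIV pA by fact
  interpret U: fin_dist UNIV pU by fact
  have rpos: "0 < r a x" for a x
  proof -
    obtain u where "pU u > 0"
      using U.sum1 U.nonneg by (metis iso_tuple_UNIV_I less_eq_real_def sum.neutral zero_neq_one)
    then show ?thesis unfolding r_def
      by (intro sum_pos2[of _ u]) (use \<open>pU u > 0\<close> U.nonneg W in \<open>auto simp: less_imp_le\<close>)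
  qed
  obtain a0 where a0: "pA a0 > 0"
    using A.sum1 A.nonneg by (metis iso_tuple_UNIV_I less_eq_real_def sum.neutral zero_neq_one)
  have vpos: "0 < v u x" for u x
    unfolding v_def by (intro sum_pos2[of _ a0]) (use a0 A.nonneg W in \<open>auto simp: less_imp_le\<close>)
  have px_r: "px x = (\<Sum>a\<in>UNIV. pA a * r a x)" for x
    by (simp add: px_def r_def sum_distrib_left)
  have pxpos: "0 < px x" for x
    unfolding px_r by (intro sum_pos2[of _ a0]) (use a0 A.nonneg rpos in \<open>auto simp: less_imp_le\<close>)
  have ln_quot: "ln (y / px x) - ln (W a u x / px x) = ln (y / W a u x)" if "0 < y" for y a u x
    using that pxpos[of x] W[of a u x] by (simp add: ln_div)
  have E_diff: "E \<phi> - E \<psi> = E (\<lambda>x a u. \<phi> x a u - \<psi> x a u)" for \<phi> \<psi>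
    by (simp add: E_def sum_subtractf[symmetric] right_diff_distrib case_prod_beta)
  define i12 where "i12 = E (\<lambda>x a u. ln (W a u x / px x))"
  define i1 where "i1 = E (\<lambda>x a u. ln (r a x / px x))"
  define i2 where "i2 = E (\<lambda>x a u. ln (v u x / px x))"
  have e1: "E (\<lambda>x a u. ln (r a x / W a u x)) = i1 - i12"
    unfolding i1_def i12_def E_diff by (simp add: ln_quot rpos)
  have e2: "E (\<lambda>x a u. ln (v u x / W a u x)) = i2 - i12"
    unfolding i2_def i12_def E_diff by (simp add: ln_quot vpos)
  \<comment> \<open>Of the margin 3 \<delta> in the rates, one \<delta> pays for the exponent of
    \<open>L0\<close>, one for that of \<open>L1\<close> or \<open>L2\<close>, and the third leaves
    the decay \<open>exp (- (real n * \<delta>))\<close>. The bound eps / 2 leaves room for typical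
    distortion and for bad source words.\<close>
  define \<delta> where "\<delta> = min (eps / 2) (min ((R1 - i1) / 3) (min ((R2 - i2) / 3) ((R1 + R2 - i12) / 3)))"
  have \<delta>: "0 < \<delta>" "\<delta> \<le> eps / 2" "i1 + 3 * \<delta> \<le> R1" "i2 + 3 * \<delta> \<le> R2" "i12 + 3 * \<delta> \<le> R1 + R2"
  proof -
    show "0 < \<delta>" using eps R1 R2 R12 by (simp add: \<delta>_def i1_def i2_def i12_def)
    have "\<delta> \<le> eps / 2" "\<delta> \<le> (R1 - i1) / 3" "\<delta> \<le> (R2 - i2) / 3" "\<delta> \<le> (R1 + R2 - i12) / 3"
      unfolding \<delta>_def by (simp_all only: min_le_iff_disj order_refl simp_thms)
    then show "\<delta> \<le> eps / 2" "i1 + 3 * \<delta> \<le> R1" "i2 + 3 * \<delta> \<le> R2" "i12 + 3 * \<delta> \<le> R1 + R2"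
      by simp_all
  qed
  define \<Phi> where "\<Phi> = {\<lambda>(x, a, u). ln (W a u x / px x), \<lambda>(x, a, u). ln (r a x / W a u x),
      \<lambda>(x, a, u). ln (v u x / W a u x), \<lambda>(x, a, u). d x (\<psi>1 a), \<lambda>(x, a, u). d x (\<psi>2 u), \<lambda>(x, a, u). d x (\<psi>12 a u)}"
  define J where "J = (\<lambda>(x, a, u). pA a * pU u * W a u x)"
  define \<mu> where "\<mu> \<phi> = (\<Sum>z\<in>UNIV. J z * \<phi> z)" for \<phi>
  have \<mu>_E: "\<mu> (\<lambda>(x, a, u). \<phi> x a u) = E \<phi>" for \<phi>
    by (simp add: \<mu>_def E_def J_def case_prod_beta)
  define V where "V = (\<Sum>\<phi>\<in>\<Phi>. \<Sum>z\<in>UNIV. J z * (\<phi> z - \<mu> \<phi>)\<^sup>2) / \<delta>\<^sup>2"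
  have Jnonneg: "0 \<le> J z" for z
    using A.nonneg U.nonneg W by (auto simp: J_def less_imp_le split: prod.splits)
  have V: "0 \<le> V" unfolding V_def by (intro divide_nonneg_nonneg sum_nonneg mult_nonneg_nonneg Jnonneg) auto
  \<comment> \<open>2 V comes from the atypical triples; three terms with factor 2, each at most
    \<open>exp (- (real n * \<delta>))\<close> and so at most 1 / (n \<delta>), give 6 /
    \<delta>.\<close>
  define C where "C = 2 * V + 6 / \<delta>"
  have C: "0 \<le> C" using V \<delta> by (simp add: C_def)
  have B: "0 \<le> B" using d order_trans by blast
  obtain K :: nat where K: "max 1 (max (1 / eps) (B * C / \<delta>)) < real K" using reals_Archimedean2 by blast
  show "\<exists>N. \<forall>n\<ge>N. \<exists>M1 M2 f1 f2 g1 g2 g12. md_code_ok px d (R1 / ln 2) (R2 / ln 2)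
    (ereal (E (\<lambda>x a u. d x (\<psi>1 a)))) (ereal (E (\<lambda>x a u. d x (\<psi>2 u)))) (ereal (E (\<lambda>x a u. d x (\<psi>12 a u))))
      eps n M1 M2 f1 f2 g1 g2 g12"
  proof (rule exI[of _ K], intro allI impI)
    fix n assume "K \<le> n"
    then have Kn: "real K \<le> real n" by simp
    have n: "0 < n" "1 / real n \<le> eps" "B * C / real n \<le> \<delta>"
    proof -
      show n0: "0 < n" using K Kn by linarith
      have "1 / eps \<le> real n" "B * C / \<delta> \<le> real n" using K Kn by linarith+
      then show "1 / real n \<le> eps" "B * C / real n \<le> \<delta>"
        using n0 eps \<delta>(1) by (simp_all add: field_simps)
    qed
    define G where "G x a u \<longleftrightarrow> (\<forall>\<phi>\<in>\<Phi>. (\<Sum>t<n. \<phi> (x!t, a!t, u!t)) \<le> real n * (\<mu> \<phi> + \<delta>))" for x a u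
    define M where "M R = nat \<lceil>exp (real n * R)\<rceil>" for R
    have M: "exp (real n * R) \<le> real (M R)" "0 < M R" for R
      by (auto simp: M_def of_nat_ceiling)
    have Mlog: "log 2 (real (M R)) / real n \<le> R / ln 2 + eps" if "0 \<le> R" for R
    proof -
      \<comment> \<open>Rounding up costs at most a factor 2, that is one bit per block, and 1 / n
        is below eps.\<close>
      have "real (M R) \<le> exp (real n * R) + 1"
        unfolding M_def by (simp add: less_imp_le)
      also have "\<dots> \<le> 2 * exp (real n * R)" using that by simp
      finally have "log 2 (real (M R)) \<le> log 2 (2 * exp (real n * R))"
        using M(2)[of R] by simp
      also have "\<dots> = 1 + real n * R / ln 2"
        by (simp add: log_mult)
      finally have "log 2 (real (M R)) / real n \<le> (1 + real n * R / ln 2) / real n"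
        by (rule divide_right_mono) simp
      also have "\<dots> = R / ln 2 + 1 / real n" using n by (simp add: field_simps)
      finally show ?thesis using n by simp
    qed
    have G_\<Phi>: "(\<Sum>t<n. \<phi> (x!t) (a!t) (u!t)) \<le> real n * (E \<phi> + \<delta>)"
      if "G x a u" "(\<lambda>(x, a, u). \<phi> x a u) \<in> \<Phi>" for x a u \<phi>
      using that(1)[unfolded G_def, rule_format, OF that(2)] by (simp add: \<mu>_E)
    have "\<exists>as\<in>nlists (M R1) (nlists n UNIV). \<exists>us\<in>nlists (M R2) (nlists n UNIV).
     (\<Sum>x\<in>nlists n UNIV. seq_prob px x * of_bool (\<forall>i<M R1. \<forall>j<M R2. \<not> G x (as ! i) (us ! j)))
       \<le> 2 * (V / real n) + 2 * exp (real n * (i12 + \<delta>)) * (1 / (real (M R1) * real (M R2))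
          + exp (real n * (i1 - i12 + \<delta>)) / real (M R1) + exp (real n * (i2 - i12 + \<delta>)) / real (M R2))"
    proof (rule random_codebooks[where W = W and G = G and px = px and r = r and v = v, OF A U W W1])
      fix x :: "'x list" and a :: "'a list" and u :: "'u list" assume G: "G x a u"
      show "(\<Prod>t<n. W (a!t) (u!t) (x!t)) \<le> exp (real n * (i12 + \<delta>)) * (\<Prod>t<n. px (x!t))"
        using G_\<Phi>[OF G, of "\<lambda>x a u. ln (W a u x / px x)"] W pxpos
        by (intro prod_le_exp_mult_prod) (auto simp: \<Phi>_def i12_def)
      show "(\<Prod>t<n. r (a!t) (x!t)) \<le> exp (real n * (i1 - i12 + \<delta>)) * (\<Prod>t<n. W (a!t) (u!t) (x!t))"
        using G_\<Phi>[OF G, of "\<lambda>x a u. ln (r a x / W a u x)"] W rpos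
        by (intro prod_le_exp_mult_prod) (auto simp: \<Phi>_def e1)
      show "(\<Prod>t<n. v (u!t) (x!t)) \<le> exp (real n * (i2 - i12 + \<delta>)) * (\<Prod>t<n. W (a!t) (u!t) (x!t))"
        using G_\<Phi>[OF G, of "\<lambda>x a u. ln (v u x / W a u x)"] W vpos
        by (intro prod_le_exp_mult_prod) (auto simp: \<Phi>_def e2)
    next
      show "(\<Sum>x\<in>nlists n UNIV. \<Sum>a\<in>nlists n UNIV. \<Sum>u\<in>nlists n UNIV.
        seq_prob pA a * seq_prob pU u * (\<Prod>t<n. W (a!t) (u!t) (x!t)) * of_bool (\<not> G x a u)) \<le> V / real n"
        unfolding G_def V_def \<mu>_def J_def
        by (rule atypical_prob_le[where W = W, OF A U W W1 _ \<delta>(1) n(1)]) (simp add: \<Phi>_def)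
    qed (use M in \<open>auto simp: r_def v_def px_def\<close>)
    then obtain as us where code:
      "(\<Sum>x\<in>nlists n UNIV. seq_prob px x * of_bool (\<forall>i<M R1. \<forall>j<M R2. \<not> G x (as ! i) (us ! j)))
       \<le> 2 * (V / real n) + 2 * exp (real n * (i12 + \<delta>)) * (1 / (real (M R1) * real (M R2))
          + exp (real n * (i1 - i12 + \<delta>)) / real (M R1) + exp (real n * (i2 - i12 + \<delta>)) / real (M R2))"
      by blast
    define bad where "bad x \<longleftrightarrow> (\<forall>i<M R1. \<forall>j<M R2. \<not> G x (as ! i) (us ! j))" for x
    have exp_small: "exp (- (real n * \<delta>)) \<le> 1 / (real n * \<delta>)"
    proof -
      have "real n * \<delta> \<le> exp (real n * \<delta>)" using exp_ge_add_one_self[of "real n * \<delta>"] by linarith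
      then have "1 / exp (real n * \<delta>) \<le> 1 / (real n * \<delta>)" using n \<delta> by (intro divide_left_mono) auto
      then show ?thesis by (simp add: exp_minus inverse_eq_divide)
    qed
    have bad: "(\<Sum>x\<in>nlists n UNIV. seq_prob px x * of_bool (bad x)) \<le> C / real n"
    proof -
      have *: "exp (real n * (i12 + \<delta>)) * (1 / (real (M R1) * real (M R2))) \<le> exp (- (real n * \<delta>))"
      proof -
        have "exp (real n * (i12 + \<delta>)) * exp (real n * \<delta>) \<le> exp (real n * R1) * exp (real n * R2)"
          unfolding exp_add[symmetric] using n \<delta> by (simp add: distrib_left[symmetric])
        also have "\<dots> \<le> real (M R1) * real (M R2)" using M by (intro mult_mono) auto
        finally show ?thesis using M by (simp add: exp_minus field_simps)
      qed
      have **: "exp (real n * (i12 + \<delta>)) * (exp (real n * (i - i12 + \<delta>)) / real (M R)) \<le> exp (- (real n * \<delta>))"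
        if "i + 3 * \<delta> \<le> R" for i R
      proof -
        have "exp (real n * (i12 + \<delta>)) * exp (real n * (i - i12 + \<delta>)) * exp (real n * \<delta>) \<le> exp (real n * R)"
          unfolding exp_add[symmetric] using n that by (simp add: distrib_left[symmetric])
        also have "\<dots> \<le> real (M R)" by (rule M)
        finally show ?thesis using M(2)[of R] by (simp add: exp_minus field_simps)
      qed
      have "(\<Sum>x\<in>nlists n UNIV. seq_prob px x * of_bool (bad x)) \<le> 2 * (V / real n) + 6 * exp (- (real n * \<delta>))"
        using code * **[OF \<delta>(3)] **[OF \<delta>(4)] unfolding bad_def by (simp add: distrib_left)
      also have "\<dots> \<le> 2 * (V / real n) + 6 * (1 / (real n * \<delta>))"
        using exp_small by simp
      also have "\<dots> = C / real n" using n \<delta> by (simp add: C_def field_simps)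
      finally show ?thesis .
    qed
    \<comment> \<open>Both encoders see all of x and can run the same search for a good pair, each
      sending its own index. The range conditions stand outside the implication so that the indices
      are valid for bad source words too.\<close>
    define F where "F x = (SOME ij. fst ij < M R1 \<and> snd ij < M R2 \<and> (\<not> bad x \<longrightarrow> G x (as ! fst ij) (us ! snd ij)))" for x
    have F: "fst (F x) < M R1 \<and> snd (F x) < M R2 \<and> (\<not> bad x \<longrightarrow> G x (as ! fst (F x)) (us ! snd (F x)))" for x
    proof -
      have "\<exists>ij. fst ij < M R1 \<and> snd ij < M R2 \<and> (\<not> bad x \<longrightarrow> G x (as ! fst ij) (us ! snd ij))"
      proof (cases "bad x")
        case True
        then show ?thesis using M(2) by (intro exI[of _ "(0, 0)"]) simp
      next
        case False
        then show ?thesis by (auto simp: bad_def)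
      qed
      then show ?thesis unfolding F_def by (rule someI_ex)
    qed
    interpret X: fin_dist UNIV px
    proof
      have "(\<Sum>x\<in>UNIV. px x) = (\<Sum>a\<in>UNIV. \<Sum>u\<in>UNIV. \<Sum>x\<in>UNIV. pA a * (pU u * W a u x))"
        unfolding px_def by (rule sum_rotate[symmetric])
      also have "\<dots> = 1"
        by (simp add: sum_distrib_left[symmetric] W1 U.sum1 A.sum1)
      finally show "sum px UNIV = 1" .
    qed (use pxpos in \<open>auto intro: less_imp_le\<close>)
    interpret SX: fin_dist "nlists n UNIV" "seq_prob px" by (rule X.fin_dist_nlists)
    have dist: "exp_dist px d n (\<lambda>x t. \<psi> (as ! fst (F x) ! t) (us ! snd (F x) ! t))
        \<le> E (\<lambda>x a u. d x (\<psi> a u)) + eps"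
      if \<psi>: "(\<lambda>(x, a, u). d x (\<psi> a u)) \<in> \<Phi>" for \<psi>
    proof -
      let ?D = "E (\<lambda>x a u. d x (\<psi> a u))"
      have D0: "0 \<le> ?D"
        unfolding E_def using A.nonneg U.nonneg W d
        by (intro sum_nonneg) (auto simp: less_imp_le)
      have "exp_dist px d n (\<lambda>x t. \<psi> (as ! fst (F x) ! t) (us ! snd (F x) ! t))
        \<le> (\<Sum>x\<in>nlists n UNIV. seq_prob px x * ((?D + \<delta>) + B * of_bool (bad x)))"
        unfolding exp_dist_def in_nlists_UNIV[symmetric] Collect_mem_eq
      proof (intro sum_mono mult_left_mono)
        fix x :: "'x list" assume x: "x \<in> nlists n UNIV"
        show "0 \<le> seq_prob px x" by (rule SX.nonneg[OF x])
        show "1 / real n * (\<Sum>t<n. d (x ! t) (\<psi> (as ! fst (F x) ! t) (us ! snd (F x) ! t)))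
          \<le> (?D + \<delta>) + B * of_bool (bad x)"
        proof (cases "bad x")
          case True
          have "(\<Sum>t<n. d (x ! t) (\<psi> (as ! fst (F x) ! t) (us ! snd (F x) ! t))) \<le> (\<Sum>t<n. B)"
            by (intro sum_mono d)
          then show ?thesis using True D0 \<delta> n by (simp add: field_simps) (smt (verit) mult_nonneg_nonneg of_nat_0_le_iff)
        next
          case False
          then have "G x (as ! fst (F x)) (us ! snd (F x))" using F by blast
          from G_\<Phi>[OF this \<psi>] show ?thesis using False n by (simp add: field_simps)
        qed
      qed
      also have "\<dots> = ?D + \<delta> + B * (\<Sum>x\<in>nlists n UNIV. seq_prob px x * of_bool (bad x))"
        by (simp only: distrib_left sum.distrib sum_distrib_right[symmetric] SX.sum1 mult.left_commute[of _ B]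
            sum_distrib_left[symmetric] mult_1)
      also have "\<dots> \<le> ?D + \<delta> + B * (C / real n)"
        using bad B by (intro add_left_mono mult_left_mono)
      also have "\<dots> \<le> ?D + eps" using n \<delta> by simp
      finally show ?thesis .
    qed
    show "\<exists>M1 M2 f1 f2 g1 g2 g12. md_code_ok px d (R1 / ln 2) (R2 / ln 2)
    (ereal (E (\<lambda>x a u. d x (\<psi>1 a)))) (ereal (E (\<lambda>x a u. d x (\<psi>2 u)))) (ereal (E (\<lambda>x a u. d x (\<psi>12 a u))))
      eps n M1 M2 f1 f2 g1 g2 g12"
    proof (intro exI)
      show "md_code_ok px d (R1 / ln 2) (R2 / ln 2)
    (ereal (E (\<lambda>x a u. d x (\<psi>1 a)))) (ereal (E (\<lambda>x a u. d x (\<psi>2 u)))) (ereal (E (\<lambda>x a u. d x (\<psi>12 a u))))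
        eps n (M R1) (M R2) (\<lambda>x. fst (F x)) (\<lambda>x. snd (F x)) (\<lambda>m t. \<psi>1 (as ! m ! t)) (\<lambda>m t. \<psi>2 (us ! m ! t))
        (\<lambda>m m' t. \<psi>12 (as ! m ! t) (us ! m' ! t))"
        unfolding md_code_ok_def
        using F Mlog R dist[of "\<lambda>a u. \<psi>1 a"] dist[of "\<lambda>a u. \<psi>2 u"] dist[of \<psi>12] by (auto simp: \<Phi>_def)
    qed
  qed
qed

section \<open>Binary entropy and the achievable point\<close>

text \<open>In nats, which keeps Gibbs' inequality free of constants; the factor \<open>ln 2\<close>
  enters only where rates in bits are compared.\<close>

definition bin_entropy :: "real \<Rightarrow> real" where
  "bin_entropy x = - x * ln x - (1 - x) * ln (1 - x)"

text \<open>Continuity on the whole line relies on \<open>ln (- x) = ln x\<close> and \<open>ln 0 = 0\<close>.\<close>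
lemma isCont_mult_ln: "isCont (\<lambda>x::real. x * ln x) x"
proof (cases "x = 0")
  case True
  have bound: "norm (y * ln y) \<le> norm (sqrt \<bar>y\<bar>) * 2" if "norm y < 1" for y :: real
  proof (cases "y = 0")
    case False
    \<comment> \<open>With \<open>\<bar>y\<bar> = s * s\<close> the absolute value is 2 s^2 (- ln
      s), and - ln s \<le> 1 / s leaves 2 s.\<close>
    define s where "s = sqrt \<bar>y\<bar>"
    have s: "0 < s" "s < 1" "\<bar>y\<bar> = s * s"
      using False that by (auto simp: s_def)
    have "ln y = ln \<bar>y\<bar>" by (cases "0 \<le> y") (simp_all add: ln_minus)
    then have ln: "ln y = 2 * ln s" using s by (simp add: ln_mult)
    have "- ln s \<le> 1 / s - 1"
      using ln_le_minus_one[of "1 / s"] s by (simp add: ln_div)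
    then have "s * s * (- ln s) \<le> s * s * (1 / s)"
      using s by (intro mult_left_mono) auto
    then have "s * s * (2 * - ln s) \<le> s * 2" using s by simp
    moreover have "norm (y * ln y) = s * s * (2 * - ln s)"
      using s by (simp add: abs_mult ln)
    moreover have "norm (sqrt \<bar>y\<bar>) = s" by (simp add: s_def)
    ultimately show ?thesis by linarith
  qed simp
  have "((\<lambda>y::real. y * ln y) \<longlongrightarrow> 0) (at 0)"
  proof (rule tendsto_0_le)
    have "isCont (\<lambda>y. sqrt \<bar>y\<bar>) 0" by (intro continuous_intros)
    then show "((\<lambda>y. sqrt \<bar>y\<bar>) \<longlongrightarrow> 0) (at 0)" by (simp add: isCont_def)
    have "eventually (\<lambda>y::real. norm y < 1) (at 0)"
      unfolding eventually_at by (intro exI[of _ 1]) simp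
    then show "\<forall>\<^sub>F y in at 0. norm (y * ln y) \<le> norm (sqrt \<bar>y\<bar>) * 2"
      by eventually_elim (rule bound)
  qed
  then show ?thesis using True by (simp add: isCont_def)
qed (intro continuous_intros)

lemma isCont_bin_entropy: "isCont bin_entropy x"
proof -
  have "isCont (\<lambda>x. (\<lambda>y. y * ln y) (1 - x)) x"
    by (rule isCont_o2[OF _ isCont_mult_ln]) (intro continuous_intros)
  then have "isCont (\<lambda>x. - (x * ln x) - (1 - x) * ln (1 - x)) x"
    by (intro continuous_diff continuous_minus isCont_mult_ln)
  then show ?thesis
    by (simp add: bin_entropy_def[abs_def])
qed

lemma bin_entropy_eps_delta:
  assumes "0 < \<kappa>"
  obtains \<delta> where "0 < \<delta>" "\<And>y. \<bar>y - x\<bar> < \<delta> \<Longrightarrow> \<bar>bin_entropy y - bin_entropy x\<bar> < \<kappa>"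
proof -
  have "\<exists>s>0. \<forall>y. y \<noteq> x \<and> norm (y - x) < s \<longrightarrow> norm (bin_entropy y - bin_entropy x) < \<kappa>"
    using isCont_bin_entropy[of x] assms unfolding isCont_def by (rule LIM_D)
  then obtain s where "s > 0" "\<And>y. y \<noteq> x \<Longrightarrow> \<bar>y - x\<bar> < s \<Longrightarrow> \<bar>bin_entropy y - bin_entropy x\<bar> < \<kappa>"
    by auto
  then have "\<bar>bin_entropy y - bin_entropy x\<bar> < \<kappa>" if "\<bar>y - x\<bar> < s" for y
    using that assms by (cases "y = x") auto
  with \<open>s > 0\<close> show ?thesis by (rule that)
qed

text \<open>The correction q - p cancels once the inequality is summed over two probability
  vectors.\<close>

lemma gibbs_term: "0 \<le> (p::real) \<Longrightarrow> 0 < q \<Longrightarrow> p * ln q \<le> p * ln p + q - p"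
proof (cases "p = 0")
  case False
  assume "0 \<le> p" "0 < q"
  then have "p * ln (q / p) \<le> p * (q / p - 1)"
    using False by (intro mult_left_mono ln_le_minus_one) auto
  then show ?thesis using False \<open>0 < q\<close> by (simp add: ln_div algebra_simps)
qed simp

lemma bin_entropy_le_cross:
  assumes "0 \<le> p" "p \<le> 1" "0 < q" "q < 1"
  shows "bin_entropy p \<le> - p * ln q - (1 - p) * ln (1 - q)"
  using gibbs_term[of p q] gibbs_term[of "1 - p" "1 - q"] assms by (simp add: bin_entropy_def)

lemma bin_entropy_half: "bin_entropy (1 / 2) = ln 2"
  by (simp add: bin_entropy_def ln_div)

lemma bin_entropy_le_ln2: "0 \<le> p \<Longrightarrow> p \<le> 1 \<Longrightarrow> bin_entropy p \<le> ln 2"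
  using bin_entropy_le_cross[of p "1 / 2"] by (simp add: ln_div algebra_simps)

text \<open>The left side is affine in d with slope ln (1 - D) - ln D \<ge> 0, and at d = D it is
  the entropy.\<close>

lemma cross_entropy_le:
  assumes "d \<le> D" "0 < D" "D \<le> 1 / 2"
  shows "- d * ln D - (1 - d) * ln (1 - D) \<le> bin_entropy D"
proof -
  have "ln D \<le> ln (1 - D)" using assms by simp
  then have "(D - d) * (ln (1 - D) - ln D) \<ge> 0" using assms by simp
  then show ?thesis by (simp add: bin_entropy_def algebra_simps)
qed

lemma bin_entropy_mono:
  assumes "0 \<le> d" "d \<le> D" "D \<le> 1 / 2"
  shows "bin_entropy d \<le> bin_entropy D"
proof (cases "D = 0")
  case False
  then show ?thesis
    using bin_entropy_le_cross[of d D] cross_entropy_le[of d D] assms by linarith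
qed (use assms in auto)

text \<open>D is the mixture of 1/2 and \<alpha> with weights 2 q and 1 - 2 q. Concavity is used
  through the tangent at D: cross entropy against D is affine in its first argument and dominates
  the entropy.\<close>

lemma bin_entropy_concave_half:
  assumes "0 < \<alpha>" "\<alpha> < 1 / 2" "0 \<le> q" "q \<le> 1 / 2" "D = q + (1 - 2 * q) * \<alpha>"
  shows "2 * q * ln 2 + (1 - 2 * q) * bin_entropy \<alpha> \<le> bin_entropy D"
proof -
  define s where "s = 2 * q * (1 / 2 - \<alpha>)"
  have "D = \<alpha> + s" using assms by (simp add: s_def algebra_simps)
  moreover have "s \<le> 1 / 2 - \<alpha>"
    using mult_right_mono[of "2 * q" 1 "1 / 2 - \<alpha>"] assms by (simp add: s_def)
  moreover have "0 \<le> s" using assms by (simp add: s_def)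
  ultimately have D: "0 < D" "D < 1" using assms by linarith+
  have "2 * q * bin_entropy (1 / 2) + (1 - 2 * q) * bin_entropy \<alpha>
      \<le> 2 * q * (- (1 / 2) * ln D - (1 - 1 / 2) * ln (1 - D)) + (1 - 2 * q) * (- \<alpha> * ln D - (1 - \<alpha>) * ln (1 - D))"
    using D assms by (intro add_mono mult_left_mono bin_entropy_le_cross) auto
  also have "\<dots> = - D * ln D - (1 - D) * ln (1 - D)"
    unfolding assms(5) by (simp add: algebra_simps)
  also have "\<dots> = bin_entropy D" by (simp add: bin_entropy_def)
  finally show ?thesis by (simp only: bin_entropy_half)
qed

section \<open>The test channel and its limit points\<close>

lemma sum_letters:
  fixes f :: "bool \<Rightarrow> bool \<Rightarrow> bool option \<Rightarrow> real"
  shows "(\<Sum>(x, a, u)\<in>UNIV. f x a u) =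
    (\<Sum>x\<in>UNIV. \<Sum>a\<in>UNIV. f x a None + f x a (Some False) + f x a (Some True))"
proof -
  have U: "(UNIV :: bool option set) = {None, Some False, Some True}"
    by (auto simp: UNIV_option_conv UNIV_bool)
  have "(\<Sum>(x, a, u)\<in>UNIV. f x a u) = (\<Sum>x\<in>UNIV. \<Sum>a\<in>UNIV. \<Sum>u\<in>UNIV. f x a u)"
    by (simp add: sum.cartesian_product UNIV_Times_UNIV[symmetric] del: UNIV_Times_UNIV)
  then show ?thesis by (simp add: U add.assoc)
qed

text \<open>The test channel: \<open>a\<close> is a fair bit, \<open>u\<close> independently is either a letter \<open>Some b\<close>, which
  fixes the joint reconstruction to be \<open>b\<close>, or \<open>None\<close>, which makes it equal to \<open>a\<close>; the source
  is the joint reconstruction seen through a binary symmetric channel.\<close>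
lemma bss_test_channel_achievable:
  assumes \<alpha>: "0 < \<alpha>" "\<alpha> < 1 / 2" and D: "\<alpha> \<le> D" "D \<le> 1 / 2"
    and R: "0 \<le> R1" "0 \<le> R2" and R1: "ln 2 - bin_entropy D < R1"
    and R2: "bin_entropy D - bin_entropy \<alpha> < R2"
  shows "md_achievable bss hamming (R1 / ln 2) (R2 / ln 2)
    (ereal D) (ereal (1 / 2 + \<alpha> - D)) (ereal \<alpha>)"
proof -
  \<comment> \<open>q is the probability of each letter \<open>Some b\<close>. Then a errs with
    probability 1/2 on weight 2 q and \<alpha> on weight 1 - 2 q; setting the total q + (1 - 2 q)
    \<alpha> equal to D determines q.\<close>
  define q where "q = (D - \<alpha>) / (1 - 2 * \<alpha>)"
  have q: "0 \<le> q" "q \<le> 1 / 2" "q * (1 - 2 * \<alpha>) = D - \<alpha>"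
    using \<alpha> D by (auto simp: q_def field_simps)
  have Dq: "D = q + (1 - 2 * q) * \<alpha>" using q(3) by (simp add: algebra_simps)
  define pU :: "bool option \<Rightarrow> real" where "pU u = (if u = None then 1 - 2 * q else q)" for u
  define c :: "bool \<Rightarrow> bool option \<Rightarrow> bool" where "c a u = (case u of None \<Rightarrow> a | Some b \<Rightarrow> b)" for a u
  define W where "W a u x = (if x = c a u then 1 - \<alpha> else \<alpha>)" for a u x
  have U: "(UNIV :: bool option set) = {None, Some False, Some True}"
    by (auto simp: UNIV_option_conv UNIV_bool)
  have A: "fin_dist UNIV bss" by unfold_locales (simp_all add: bss_def)
  have pU: "fin_dist UNIV pU"
    using q by unfold_locales (simp_all add: pU_def U)
  have W0: "0 < W a u x" for a u x using \<alpha> by (simp add: W_def)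
  have W1: "(\<Sum>x\<in>UNIV. W a u x) = 1" for a u by (simp add: UNIV_bool W_def)
  define r where "r a x = (\<Sum>u\<in>UNIV. pU u * W a u x)" for a x
  define v where "v u x = (\<Sum>a\<in>UNIV. bss a * W a u x)" for u x
  define px where "px x = (\<Sum>a\<in>UNIV. \<Sum>u\<in>UNIV. bss a * (pU u * W a u x))" for x
  define E where "E \<phi> = (\<Sum>(x, a, u)\<in>UNIV. bss a * pU u * W a u x * \<phi> x a u)" for \<phi> :: "bool \<Rightarrow> bool \<Rightarrow> bool option \<Rightarrow> real"
  have r: "r a x = (if x = a then 1 - D else D)" for a x
    unfolding r_def U Dq by (cases a; cases x) (simp_all add: pU_def W_def c_def algebra_simps)
  have v: "v u x = (case u of None \<Rightarrow> 1 / 2 | Some b \<Rightarrow> if x = b then 1 - \<alpha> else \<alpha>)" for u x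
    by (cases u; cases x) (simp_all add: v_def UNIV_bool bss_def W_def c_def field_simps)
  have px_r: "px x = (\<Sum>a\<in>UNIV. bss a * r a x)" for x
    by (simp add: px_def r_def sum_distrib_left)
  have px: "px = bss"
    by (rule ext) (simp add: px_r r UNIV_bool bss_def split: if_splits)
  have D': "0 < D" "D < 1" using \<alpha> D by auto
  have E_a: "E (\<lambda>x a u. if x = a then l else l') = (1 - D) * l + D * l'" for l l'
    unfolding E_def sum_letters Dq by (simp add: UNIV_bool bss_def pU_def W_def c_def field_simps)
  have E_c: "E (\<lambda>x a u. if x = c a u then l else l') = (1 - \<alpha>) * l + \<alpha> * l'" for l l'
    unfolding E_def sum_letters by (simp add: UNIV_bool bss_def pU_def W_def c_def field_simps)
  have E_u: "E (\<lambda>x a u. case u of None \<Rightarrow> k x | Some b \<Rightarrow> if x = b then l else l')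
      = (1 - 2 * q) * (k True + k False) / 2 + 2 * q * ((1 - \<alpha>) * l + \<alpha> * l')" for k l l'
    unfolding E_def sum_letters by (simp add: UNIV_bool bss_def pU_def W_def c_def field_simps)
  have eq: "(\<lambda>x a u. ln (r a x / px x)) = (\<lambda>x a u. if x = a then ln 2 + ln (1 - D) else ln 2 + ln D)"
    using D' by (auto simp: fun_eq_iff r px bss_def ln_mult)
  have E1: "E (\<lambda>x a u. ln (r a x / px x)) = ln 2 - bin_entropy D"
    unfolding eq E_a by (simp add: bin_entropy_def algebra_simps)
  have eq: "(\<lambda>x a u. ln (v u x / px x)) = (\<lambda>x a u. case u of None \<Rightarrow> 0 | Some b \<Rightarrow>
      if x = b then ln 2 + ln (1 - \<alpha>) else ln 2 + ln \<alpha>)"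
    using \<alpha> by (auto simp: fun_eq_iff v px bss_def ln_mult ln_div split: option.splits)
  have E2: "E (\<lambda>x a u. ln (v u x / px x)) = 2 * q * (ln 2 - bin_entropy \<alpha>)"
    unfolding eq E_u by (simp add: bin_entropy_def algebra_simps)
  have eq: "(\<lambda>x a u. ln (W a u x / px x)) = (\<lambda>x a u. if x = c a u then ln 2 + ln (1 - \<alpha>) else ln 2 + ln \<alpha>)"
    using \<alpha> by (auto simp: fun_eq_iff W_def px bss_def ln_mult)
  have E12: "E (\<lambda>x a u. ln (W a u x / px x)) = ln 2 - bin_entropy \<alpha>"
    unfolding eq E_c by (simp add: bin_entropy_def algebra_simps)
  \<comment> \<open>On \<open>None\<close> the second decoder has no information, and the fixed
    guess \<open>False\<close> errs half of the time. In total this is (1 - 2 q) / 2 + 2 q \<alpha>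
    = 1/2 + \<alpha> - D.\<close>
  define \<psi> where "\<psi> u = (case u of None \<Rightarrow> False | Some b \<Rightarrow> b)" for u :: "bool option"
  have "md_achievable px hamming (R1 / ln 2) (R2 / ln 2)
    (ereal (E (\<lambda>x a u. hamming x (id a)))) (ereal (E (\<lambda>x a u. hamming x (\<psi> u)))) (ereal (E (\<lambda>x a u. hamming x (c a u))))"
  proof (rule independent_descriptions_achievable[where W = W and B = 1 and r = r and v = v and E = E,
        OF A pU W0 W1 _ _ r_def v_def px_def E_def R])
    have "2 * q * (ln 2 - bin_entropy \<alpha>) \<le> bin_entropy D - bin_entropy \<alpha>"
      using bin_entropy_concave_half[OF \<alpha> q(1,2) Dq] by (simp add: algebra_simps)
    then show "E (\<lambda>x a u. ln (v u x / px x)) < R2"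
      using R2 E2 by simp
  qed (use R1 R2 E1 E12 in \<open>auto simp: hamming_def\<close>)
  moreover have "E (\<lambda>x a u. hamming x (id a)) = D"
  proof -
    have eq: "(\<lambda>x a (u::bool option). hamming x (id a)) = (\<lambda>x a u. if x = a then 0 else 1)"
      by (auto simp: fun_eq_iff hamming_def)
    show ?thesis unfolding eq E_a by simp
  qed
  moreover have "E (\<lambda>x a u. hamming x (\<psi> u)) = 1 / 2 + \<alpha> - D"
  proof -
    have eq: "(\<lambda>x (a::bool) u. hamming x (\<psi> u)) = (\<lambda>x a u. case u of None \<Rightarrow> of_bool x | Some b \<Rightarrow> if x = b then 0 else 1)"
      by (auto simp: fun_eq_iff hamming_def \<psi>_def split: option.splits)
    show ?thesis unfolding eq E_u using q(3) by (simp add: field_simps)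
  qed
  moreover have "E (\<lambda>x a u. hamming x (c a u)) = \<alpha>"
  proof -
    have eq: "(\<lambda>x a u. hamming x (c a u)) = (\<lambda>x a u. if x = c a u then 0 else 1)"
      by (auto simp: fun_eq_iff hamming_def)
    show ?thesis unfolding eq E_c by simp
  qed
  ultimately show ?thesis by (simp add: px)
qed

lemma md_code_ok_mono:
  assumes "md_code_ok p d R1 R2 (ereal D1) (ereal D2) (ereal D12) \<epsilon> n M1 M2 f1 f2 g1 g2 g12"
    and "R1 + \<epsilon> \<le> R1' + \<epsilon>'" "R2 + \<epsilon> \<le> R2' + \<epsilon>'" "D1 + \<epsilon> \<le> D1' + \<epsilon>'" "D2 + \<epsilon> \<le> D2' + \<epsilon>'" "D12 + \<epsilon> \<le> D12' + \<epsilon>'"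
  shows "md_code_ok p d R1' R2' (ereal D1') (ereal D2') (ereal D12') \<epsilon>' n M1 M2 f1 f2 g1 g2 g12"
  using assms by (auto simp: md_code_ok_def)

text \<open>The test channel covers only \<alpha> strictly between 0 and 1/2 and rates strictly
  above the information quantities. For each eps a nearby interior point is coded instead, and its
  offset is absorbed by eps.\<close>

lemma bss_md_achievable:
  assumes "0 \<le> D12" "D12 \<le> D1" "D1 \<le> 1 / 2"
  shows "md_achievable bss hamming (1 - bin_entropy D1 / ln 2) ((bin_entropy D1 - bin_entropy D12) / ln 2)
    (ereal D1) (ereal (1 / 2 + D12 - D1)) (ereal D12)"
  unfolding md_achievable_def
proof (intro allI impI)
  fix eps :: real assume eps: "0 < eps"
  define \<kappa> where "\<kappa> = eps * ln 2 / 8"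
  have \<kappa>: "0 < \<kappa>" using eps by (simp add: \<kappa>_def)
  obtain \<delta>1 where \<delta>1: "0 < \<delta>1" "\<And>y. \<bar>y - D1\<bar> < \<delta>1 \<Longrightarrow> \<bar>bin_entropy y - bin_entropy D1\<bar> < \<kappa>"
    using bin_entropy_eps_delta[OF \<kappa>, of D1] by blast
  obtain \<delta>2 where \<delta>2: "0 < \<delta>2" "\<And>y. \<bar>y - D12\<bar> < \<delta>2 \<Longrightarrow> \<bar>bin_entropy y - bin_entropy D12\<bar> < \<kappa>"
    using bin_entropy_eps_delta[OF \<kappa>, of D12] by blast
  define \<tau> where "\<tau> = min (min \<delta>1 \<delta>2) (min (eps / 4) (1 / 2))"
  have \<tau>: "0 < \<tau>" "\<tau> \<le> \<delta>1" "\<tau> \<le> \<delta>2" "\<tau> \<le> eps / 4" "\<tau> < 1"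
    using \<delta>1 \<delta>2 eps by (simp_all add: \<tau>_def)
  \<comment> \<open>Contracting both distortions towards 1/4 by the same fraction keeps their order
    and moves them off 0 and 1/2, whichever endpoint they started from.\<close>
  define \<alpha> where "\<alpha> = D12 + \<tau> * (1 / 4 - D12)"
  define D where "D = D1 + \<tau> * (1 / 4 - D1)"
  have close: "\<bar>\<tau> * (1 / 4 - x)\<bar> < \<tau>" if "0 \<le> x" "x \<le> 1 / 2" for x
  proof -
    have "\<tau> * \<bar>1 / 4 - x\<bar> < \<tau> * 1" using that \<tau> by (intro mult_strict_left_mono) auto
    then show ?thesis using \<tau> by (simp add: abs_mult)
  qed
  have cl: "\<bar>\<alpha> - D12\<bar> < \<tau>" "\<bar>D - D1\<bar> < \<tau>"
    using close[of D12] close[of D1] assms by (auto simp: \<alpha>_def D_def)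
  have \<alpha>: "0 < \<alpha>" "\<alpha> < 1 / 2" "\<alpha> \<le> D" "D \<le> 1 / 2"
  proof -
    have *: "\<alpha> = (1 - \<tau>) * D12 + \<tau> / 4" "D = (1 - \<tau>) * D1 + \<tau> / 4"
      by (simp_all add: \<alpha>_def D_def algebra_simps)
    have "0 \<le> (1 - \<tau>) * D12" "(1 - \<tau>) * D12 \<le> (1 - \<tau>) * D1" "(1 - \<tau>) * D1 \<le> (1 - \<tau>) * (1 / 2)"
      using assms \<tau> by (auto intro: mult_left_mono)
    then show "0 < \<alpha>" "\<alpha> < 1 / 2" "\<alpha> \<le> D" "D \<le> 1 / 2"
      unfolding * using \<tau> by (auto simp: algebra_simps)
  qed
  have HD: "\<bar>bin_entropy D - bin_entropy D1\<bar> < \<kappa>" using \<delta>1(2)[of D] cl \<tau> by simp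
  have HA: "\<bar>bin_entropy \<alpha> - bin_entropy D12\<bar> < \<kappa>" using \<delta>2(2)[of \<alpha>] cl \<tau> by simp
  define R1 where "R1 = ln 2 - bin_entropy D + \<kappa>"
  define R2 where "R2 = bin_entropy D - bin_entropy \<alpha> + \<kappa>"
  have "md_achievable bss hamming (R1 / ln 2) (R2 / ln 2) (ereal D) (ereal (1 / 2 + \<alpha> - D)) (ereal \<alpha>)"
    using \<alpha> bin_entropy_le_ln2[of D] bin_entropy_mono[of \<alpha> D] \<kappa>
    by (intro bss_test_channel_achievable) (auto simp: R1_def R2_def)
  then obtain N where N: "\<And>n. n \<ge> N \<Longrightarrow> \<exists>M1 M2 f1 f2 g1 g2 g12.
      md_code_ok bss hamming (R1 / ln 2) (R2 / ln 2) (ereal D) (ereal (1 / 2 + \<alpha> - D)) (ereal \<alpha>)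
        (eps / 4) n M1 M2 f1 f2 g1 g2 g12"
    unfolding md_achievable_def using eps by (meson divide_pos_pos zero_less_numeral)
  have R1': "R1 / ln 2 + eps / 4 \<le> 1 - bin_entropy D1 / ln 2 + eps"
  proof -
    have "R1 \<le> ln 2 - bin_entropy D1 + 2 * \<kappa>" using HD by (simp add: R1_def)
    then have "R1 / ln 2 \<le> (ln 2 - bin_entropy D1 + 2 * \<kappa>) / ln 2" by (rule divide_right_mono) simp
    then show ?thesis using eps by (simp add: \<kappa>_def diff_divide_distrib add_divide_distrib)
  qed
  have R2': "R2 / ln 2 + eps / 4 \<le> (bin_entropy D1 - bin_entropy D12) / ln 2 + eps"
  proof -
    have "R2 \<le> bin_entropy D1 - bin_entropy D12 + 3 * \<kappa>" using HD HA by (simp add: R2_def)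
    then have "R2 / ln 2 \<le> (bin_entropy D1 - bin_entropy D12 + 3 * \<kappa>) / ln 2" by (rule divide_right_mono) simp
    then show ?thesis using eps by (simp add: \<kappa>_def add_divide_distrib)
  qed
  show "\<exists>N. \<forall>n\<ge>N. \<exists>M1 M2 f1 f2 g1 g2 g12.
      md_code_ok bss hamming (1 - bin_entropy D1 / ln 2) ((bin_entropy D1 - bin_entropy D12) / ln 2)
        (ereal D1) (ereal (1 / 2 + D12 - D1)) (ereal D12) eps n M1 M2 f1 f2 g1 g2 g12"
  proof (rule exI[of _ N], intro allI impI)
    fix n assume "N \<le> n"
    from N[OF this] obtain M1 M2 f1 f2 g1 g2 g12 where
      "md_code_ok bss hamming (R1 / ln 2) (R2 / ln 2) (ereal D) (ereal (1 / 2 + \<alpha> - D)) (ereal \<alpha>)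
        (eps / 4) n M1 M2 f1 f2 g1 g2 g12" by blast
    then have "md_code_ok bss hamming (1 - bin_entropy D1 / ln 2) ((bin_entropy D1 - bin_entropy D12) / ln 2)
        (ereal D1) (ereal (1 / 2 + D12 - D1)) (ereal D12) eps n M1 M2 f1 f2 g1 g2 g12"
      by (rule md_code_ok_mono) (use R1' R2' cl \<tau> in auto)
    then show "\<exists>M1 M2 f1 f2 g1 g2 g12.
      md_code_ok bss hamming (1 - bin_entropy D1 / ln 2) ((bin_entropy D1 - bin_entropy D12) / ln 2)
        (ereal D1) (ereal (1 / 2 + D12 - D1)) (ereal D12) eps n M1 M2 f1 f2 g1 g2 g12"
      by blast
  qed
qed

section \<open>The rate-distortion function of the binary symmetric source\<close>

text \<open>Gibbs' inequality compares the posterior W x y / (2 m y) of the source with the backward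
  symmetric channel \<open>Q\<close>. The linear corrections cancel because both joint laws have
  total mass one.\<close>

lemma mutual_info_bss_ge:
  assumes W: "is_channel W" and d: "(\<Sum>x\<in>UNIV. \<Sum>y\<in>UNIV. bss x * W x y * hamming x y) \<le> D"
    and D: "0 < D" "D \<le> 1 / 2"
  shows "1 - bin_entropy D / ln 2 \<le> mutual_info bss W"
proof -
  define m where "m y = (\<Sum>x\<in>UNIV. bss x * W x y)" for y
  define Q where "Q x y = (if x = y then 1 - D else D)" for x y :: bool
  have W0: "0 \<le> W x y" for x y using W by (simp add: is_channel_def)
  have WT: "W x True = 1 - W x False" for x
  proof -
    have "(\<Sum>y\<in>UNIV. W x y) = 1" using W by (simp add: is_channel_def)
    then show ?thesis by (simp add: UNIV_bool)
  qed
  have Q0: "0 < Q x y" for x y using D by (simp add: Q_def)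
  have m0: "0 \<le> m y" for y using W0 by (simp add: m_def UNIV_bool bss_def)
  have term_ge: "bss x * W x y * ln (2 * Q x y) + bss x * W x y - Q x y * m y
      \<le> (if bss x * W x y = 0 then 0 else bss x * W x y * log 2 (W x y / m y)) * ln 2" for x y
  proof (cases "W x y = 0")
    case True
    then show ?thesis using Q0[of x y] m0[of y] by simp
  next
    case False
    then have Wp: "0 < W x y" using W0[of x y] by simp
    then have mp: "0 < m y"
      using W0 by (cases x; auto simp: m_def UNIV_bool bss_def add_pos_nonneg add_nonneg_pos)
    have "ln (2 * Q x y * m y / W x y) \<le> 2 * Q x y * m y / W x y - 1"
      using Wp mp Q0 by (intro ln_le_minus_one) simp
    moreover have "ln (2 * Q x y * m y / W x y) = ln (2 * Q x y) - ln (W x y / m y)"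
      using Wp mp Q0[of x y] by (simp add: ln_div ln_mult)
    ultimately have "ln (2 * Q x y) + 1 - 2 * Q x y * m y / W x y \<le> ln (W x y / m y)"
      by simp
    then have "W x y / 2 * (ln (2 * Q x y) + 1 - 2 * Q x y * m y / W x y) \<le> W x y / 2 * ln (W x y / m y)"
      using Wp by (intro mult_left_mono) auto
    then show ?thesis using Wp by (simp add: bss_def log_def algebra_simps)
  qed
  define \<delta> where "\<delta> = (\<Sum>x\<in>UNIV. \<Sum>y\<in>UNIV. bss x * W x y * hamming x y)"
  have "ln 2 - bin_entropy D \<le> ln 2 + (\<delta> * ln D + (1 - \<delta>) * ln (1 - D))"
    using cross_entropy_le[of \<delta> D] d D by (simp add: \<delta>_def)
  also have "\<dots> = (\<Sum>x\<in>UNIV. \<Sum>y\<in>UNIV. bss x * W x y * ln (2 * Q x y) + bss x * W x y - Q x y * m y)"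
    using D by (simp add: UNIV_bool bss_def hamming_def \<delta>_def Q_def m_def WT ln_mult field_simps)
  also have "\<dots> \<le> (\<Sum>x\<in>UNIV. \<Sum>y\<in>UNIV.
      (if bss x * W x y = 0 then 0 else bss x * W x y * log 2 (W x y / m y)) * ln 2)"
    by (intro sum_mono term_ge)
  also have "\<dots> = mutual_info bss W * ln 2"
    by (simp only: mutual_info_def m_def sum_distrib_right)
  finally show ?thesis by (simp add: field_simps)
qed

lemma rate_dist_bss:
  assumes "0 \<le> D" "D \<le> 1 / 2"
  shows "rate_dist bss hamming D = 1 - bin_entropy D / ln 2"
  unfolding rate_dist_def
proof (rule cInf_eq_minimum)
  define W where "W x y = (if x = y then 1 - D else D)" for x y :: bool
  have "mutual_info bss W = 1 - bin_entropy D / ln 2"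
  proof -
    have m: "(\<Sum>x\<in>UNIV. bss x * W x y) = 1 / 2" for y
      by (cases y) (simp_all add: UNIV_bool bss_def W_def field_simps)
    have "mutual_info bss W = (\<Sum>x\<in>UNIV. \<Sum>y\<in>UNIV. W x y / 2 * (ln (2 * W x y) / ln 2))"
      unfolding mutual_info_def m by (intro sum.cong refl) (auto simp: bss_def log_def mult.commute)
    also have "\<dots> = 1 - bin_entropy D / ln 2"
      using assms by (cases "D = 0") (simp_all add: UNIV_bool W_def ln_mult bin_entropy_def field_simps)
    finally show ?thesis .
  qed
  moreover have "is_channel W"
    using assms by (auto simp: is_channel_def W_def UNIV_bool)
  moreover have "(\<Sum>x\<in>UNIV. \<Sum>y\<in>UNIV. bss x * W x y * hamming x y) \<le> D"
    by (simp add: UNIV_bool bss_def W_def hamming_def)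
  ultimately show "1 - bin_entropy D / ln 2 \<in> {mutual_info bss W |W. is_channel W \<and>
      (\<Sum>x\<in>UNIV. \<Sum>y\<in>UNIV. bss x * W x y * hamming x y) \<le> D}"
    by (intro CollectI exI[of _ W]) simp
next
  fix I assume "I \<in> {mutual_info bss W |W. is_channel W \<and>
      (\<Sum>x\<in>UNIV. \<Sum>y\<in>UNIV. bss x * W x y * hamming x y) \<le> D}"
  then obtain W where I: "I = mutual_info bss W" and W: "is_channel W"
    and d: "(\<Sum>x\<in>UNIV. \<Sum>y\<in>UNIV. bss x * W x y * hamming x y) \<le> D" by blast
  show "1 - bin_entropy D / ln 2 \<le> I"
  proof (rule field_le_epsilon)
    fix e :: real assume "0 < e"
    then have "0 < e * ln 2" by simp
    then obtain \<delta> where \<delta>: "0 < \<delta>" "\<And>y. \<bar>y - D\<bar> < \<delta> \<Longrightarrow> \<bar>bin_entropy y - bin_entropy D\<bar> < e * ln 2"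
      by (rule bin_entropy_eps_delta[where x = D]) blast
    \<comment> \<open>The case D = 0 is reached from above: a channel of distortion at most D is
      also admissible for the positive D', and continuity of the entropy brings D' back to
      D.\<close>
    define D' where "D' = min (1 / 2) (D + \<delta> / 2)"
    have D': "0 < D'" "D' \<le> 1 / 2" "D \<le> D'" "\<bar>D' - D\<bar> < \<delta>"
      using \<delta>(1) assms by (auto simp: D'_def min_def)
    have "1 - bin_entropy D' / ln 2 \<le> I"
      unfolding I using d D' by (intro mutual_info_bss_ge[OF W]) auto
    moreover have "bin_entropy D' / ln 2 \<le> (bin_entropy D + e * ln 2) / ln 2"
      using \<delta>(2)[OF D'(4)] by (intro divide_right_mono) auto
    ultimately show "1 - bin_entropy D / ln 2 \<le> I + e"
      by (simp add: add_divide_distrib)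
  qed
qed

section \<open>Converse\<close>

definition fair_avg :: "nat \<Rightarrow> (bool list \<Rightarrow> real) \<Rightarrow> real" where
  "fair_avg n F = (\<Sum>x\<in>nlists n UNIV. F x) / 2 ^ n"

definition pm :: "bool \<Rightarrow> real" where
  "pm b = (if b then 1 else -1)"

lemma pm_simps [simp]: "pm b * pm b = 1" "\<bar>pm b\<bar> = 1"
  by (simp_all add: pm_def)

lemma card_nlists_bool: "card (nlists n (UNIV :: bool set)) = 2 ^ n"
  using card_lists_length_eq[of "UNIV :: bool set" n] unfolding nlists_def by simp

lemma fair_avg_const [simp]: "fair_avg n (\<lambda>x. c) = c"
  by (simp add: fair_avg_def card_nlists_bool)

lemma fair_avg_add: "fair_avg n (\<lambda>x. F x + G x) = fair_avg n F + fair_avg n G"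
  by (simp add: fair_avg_def sum.distrib add_divide_distrib)

lemma fair_avg_diff: "fair_avg n (\<lambda>x. F x - G x) = fair_avg n F - fair_avg n G"
  by (simp add: fair_avg_def sum_subtractf diff_divide_distrib)

lemma fair_avg_cmult: "fair_avg n (\<lambda>x. c * F x) = c * fair_avg n F"
  by (simp add: fair_avg_def sum_distrib_left)

lemma fair_avg_mono:
  "(\<And>x. x \<in> nlists n UNIV \<Longrightarrow> F x \<le> G x) \<Longrightarrow> fair_avg n F \<le> fair_avg n G"
  unfolding fair_avg_def by (intro divide_right_mono sum_mono) auto

lemma fair_avg_cong:
  "(\<And>x. x \<in> nlists n UNIV \<Longrightarrow> F x = G x) \<Longrightarrow> fair_avg n F = fair_avg n G"
  unfolding fair_avg_def by (auto intro: arg_cong2[of _ _ _ _ "(/)"] sum.cong)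

lemma exp_dist_bss:
  "exp_dist bss hamming n g = fair_avg n (\<lambda>x. (\<Sum>t<n. hamming (x ! t) (g x t)) / real n)"
  unfolding exp_dist_def in_nlists_UNIV[symmetric] Collect_mem_eq fair_avg_def
  by (subst sum_divide_distrib, intro sum.cong refl) (simp add: seq_prob_nlists bss_def power_divide)

text \<open>Jensen for \<open>ln\<close> through its tangent at c. The rate inequalities of the
  converse all arise from a well-chosen \<open>K\<close> whose average involves the number of
  messages.\<close>

lemma fair_avg_ln_le:
  assumes "\<And>x. x \<in> nlists n UNIV \<Longrightarrow> 0 < K x" "fair_avg n K \<le> c" "0 < c"
  shows "fair_avg n (\<lambda>x. ln (K x)) \<le> ln c"
proof -
  have "fair_avg n (\<lambda>x. ln (K x)) \<le> fair_avg n (\<lambda>x. (ln c - 1) + (1 / c) * K x)"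
  proof (rule fair_avg_mono)
    fix x :: "bool list" assume "x \<in> nlists n UNIV"
    then have "0 < K x" by (rule assms)
    then show "ln (K x) \<le> (ln c - 1) + (1 / c) * K x"
      using ln_le_minus_one[of "K x / c"] assms(3) by (simp add: ln_div)
  qed
  also have "\<dots> = (ln c - 1) + (1 / c) * fair_avg n K"
    by (simp only: fair_avg_add fair_avg_const fair_avg_cmult)
  also have "\<dots> \<le> ln c"
    using assms(2,3) by (simp add: field_simps)
  finally show ?thesis .
qed

lemma sum_nlists_bool_prod:
  "(\<Sum>x\<in>nlists n UNIV. \<Prod>t<n. K t (x ! t)) = (\<Prod>t<n. K t True + K t False :: real)"
  using sum_nlists_prod[of "UNIV :: bool set" K n] by (simp add: UNIV_bool add.commute)

text \<open>Replaces the message actually sent by a sum over all messages. For a fixed message a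
  normalised density sums to one over the source words, so the number of messages is what
  remains.\<close>

lemma sum_fibre_le:
  fixes H :: "'a \<Rightarrow> 'b \<Rightarrow> real"
  assumes "finite S" "finite T" "\<And>x. x \<in> S \<Longrightarrow> f x \<in> T" "\<And>m x. 0 \<le> H m x"
  shows "(\<Sum>x\<in>S. H (f x) x) \<le> (\<Sum>m\<in>T. \<Sum>x\<in>S. H m x)"
proof -
  have "H (f x) x \<le> (\<Sum>m\<in>T. H m x)" if "x \<in> S" for x
    using assms that by (intro member_le_sum) auto
  then have "(\<Sum>x\<in>S. H (f x) x) \<le> (\<Sum>x\<in>S. \<Sum>m\<in>T. H m x)" by (rule sum_mono)
  also have "\<dots> = (\<Sum>m\<in>T. \<Sum>x\<in>S. H m x)" by (rule sum.swap)
  finally show ?thesis .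
qed

lemma ln_one_plus_ge:
  assumes "\<bar>y\<bar> \<le> 1 / 2"
  shows "y - 2 * y\<^sup>2 \<le> ln (1 + y :: real)"
proof (cases "0 \<le> y")
  case True
  then have "y - y\<^sup>2 \<le> ln (1 + y)" using assms by (intro ln_one_plus_pos_lower_bound) auto
  then show ?thesis using zero_le_power2[of y] by linarith
next
  case False
  then show ?thesis using ln_one_minus_pos_lower_bound[of "- y"] assms by simp
qed

text \<open>The Gibbs inequality against the product of binary symmetric channels with crossover
  probability \<open>D\<close>, each tilted by \<open>1 + \<theta> s (Z - D)\<close> where \<open>Z\<close> is the error indicator: a code of
  nearly optimal rate makes \<open>Z - D\<close> nearly uncorrelated with every function of the message.\<close>
lemma tilted_converse:
  fixes f :: "bool list \<Rightarrow> 'm" and T :: "'m set" and g :: "'m \<Rightarrow> nat \<Rightarrow> bool" and s :: "'m \<Rightarrow> nat \<Rightarrow> real"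
  assumes T: "finite T" "\<And>x. x \<in> nlists n UNIV \<Longrightarrow> f x \<in> T"
    and D: "0 < D" "D \<le> 1 / 2" and \<theta>: "0 \<le> \<theta>" "\<theta> \<le> 1 / 2" and s: "\<And>m t. \<bar>s m t\<bar> \<le> 1"
    and d: "fair_avg n (\<lambda>x. \<Sum>t<n. hamming (x ! t) (g (f x) t)) \<le> real n * (D + \<kappa>)"
  shows "\<theta> * fair_avg n (\<lambda>x. \<Sum>t<n. s (f x) t * (hamming (x ! t) (g (f x) t) - D))
     \<le> ln (card T) - real n * (ln 2 - bin_entropy D) + real n * \<kappa> * (ln (1 - D) - ln D) + 2 * real n * \<theta>\<^sup>2"
proof -
  let ?Z = "\<lambda>x t. hamming (x ! t) (g (f x) t)"
  \<comment> \<open>Under the symmetric channel Z - D has mean zero, so the tilted values again sum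
    to one. The tilt term is at most \<theta> \<le> 1/2 in absolute value, which gives positivity
    and the quadratic bound on its logarithm.\<close>
  define q where "q m t b = (if b = g m t then (1 - D) * (1 - \<theta> * s m t * D) else D * (1 + \<theta> * s m t * (1 - D)))" for m t b
  have \<theta>s: "\<bar>\<theta> * s m t * y\<bar> \<le> \<theta>" if "\<bar>y\<bar> \<le> 1" for m t y
    using mult_mono[OF mult_mono[of "\<bar>\<theta>\<bar>" \<theta> "\<bar>s m t\<bar>" 1] that] \<theta> s[of m t] by (simp add: abs_mult)
  have D1: "\<bar>D\<bar> \<le> 1" "\<bar>1 - D\<bar> \<le> 1" "\<bar>0 - D\<bar> \<le> 1" using D by auto
  have qpos: "0 < q m t b" for m t b
    using \<theta>s[OF D1(1), of m t] \<theta>s[OF D1(2), of m t] D \<theta> unfolding q_def by (auto intro!: mult_pos_pos)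
  have qsum: "q m t True + q m t False = 1" for m t
    by (simp add: q_def algebra_simps)
  have T_pos: "0 < card T"
  proof -
    obtain x :: "bool list" where "x \<in> nlists n UNIV" using nlists_not_empty by blast
    then show ?thesis using T card_gt_0_iff by blast
  qed
  \<comment> \<open>The factor \<open>2 ^ n\<close> makes this the likelihood ratio against the
    uniform source.\<close>
  define K where "K x = 2 ^ n * (\<Prod>t<n. q (f x) t (x ! t))" for x
  have "fair_avg n K = (\<Sum>x\<in>nlists n UNIV. \<Prod>t<n. q (f x) t (x ! t))"
    by (simp add: fair_avg_def K_def sum_distrib_left[symmetric])
  also have "\<dots> \<le> (\<Sum>m\<in>T. \<Sum>x\<in>nlists n UNIV. \<Prod>t<n. q m t (x ! t))"
    using T qpos by (intro sum_fibre_le prod_nonneg) (auto simp: less_imp_le)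
  also have "\<dots> = real (card T)"
    by (simp add: sum_nlists_bool_prod qsum)
  finally have le: "fair_avg n (\<lambda>x. ln (K x)) \<le> ln (card T)"
    using T_pos by (intro fair_avg_ln_le[where K = K]) (auto simp: K_def qpos intro!: mult_pos_pos prod_pos)
  let ?c = "real n * (ln 2 + ln (1 - D) - 2 * \<theta>\<^sup>2)"
  have lnK: "?c + ((ln D - ln (1 - D)) * (\<Sum>t<n. ?Z x t) + \<theta> * (\<Sum>t<n. s (f x) t * (?Z x t - D))) \<le> ln (K x)" for x
  proof -
    have term_le: "ln (1 - D) - 2 * \<theta>\<^sup>2 + (ln D - ln (1 - D)) * ?Z x t + \<theta> * (s (f x) t * (?Z x t - D)) \<le> ln (q (f x) t (x ! t))" for t
    proof -
      define y where "y = \<theta> * s (f x) t * (?Z x t - D)"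
      have y: "\<bar>y\<bar> \<le> \<theta>" unfolding y_def by (rule \<theta>s) (use D in \<open>simp add: hamming_def\<close>)
      then have "y\<^sup>2 \<le> \<theta>\<^sup>2" using \<theta> by (simp add: abs_le_square_iff[symmetric])
      moreover have "y - 2 * y\<^sup>2 \<le> ln (1 + y)" using y \<theta> by (intro ln_one_plus_ge) auto
      moreover have "ln (q (f x) t (x ! t)) = ln (1 - D) + (ln D - ln (1 - D)) * ?Z x t + ln (1 + y)"
      proof (cases "x ! t = g (f x) t")
        case True
        then have "q (f x) t (x ! t) = (1 - D) * (1 + y)" by (simp add: q_def y_def hamming_def)
        then show ?thesis using True D y \<theta> by (simp add: hamming_def ln_mult_pos)
      next
        case False
        then have "q (f x) t (x ! t) = D * (1 + y)" by (simp add: q_def y_def hamming_def)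
        then show ?thesis using False D y \<theta> by (simp add: hamming_def ln_mult_pos)
      qed
      ultimately show ?thesis by (simp add: y_def mult.assoc)
    qed
    have "ln (K x) = real n * ln 2 + (\<Sum>t<n. ln (q (f x) t (x ! t)))"
      unfolding K_def using qpos by (simp add: ln_mult ln_prod prod_pos ln_realpow less_imp_neq[symmetric])
    also have "\<dots> \<ge> real n * ln 2 + (\<Sum>t<n. ln (1 - D) - 2 * \<theta>\<^sup>2 + (ln D - ln (1 - D)) * ?Z x t + \<theta> * (s (f x) t * (?Z x t - D)))"
      by (intro add_left_mono sum_mono term_le)
    finally show ?thesis
      by (simp add: sum.distrib sum_subtractf sum_distrib_left[symmetric] algebra_simps)
  qed
  have "?c + ((ln D - ln (1 - D)) * fair_avg n (\<lambda>x. \<Sum>t<n. ?Z x t)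
      + \<theta> * fair_avg n (\<lambda>x. \<Sum>t<n. s (f x) t * (?Z x t - D))) \<le> fair_avg n (\<lambda>x. ln (K x))"
    using fair_avg_mono[of n _ "\<lambda>x. ln (K x)", OF lnK]
    by (simp add: fair_avg_add fair_avg_cmult)
  \<comment> \<open>The log odds are nonpositive for D \<le> 1/2, so the upper bound on the
    distortion becomes a lower bound here.\<close>
  moreover have "(ln D - ln (1 - D)) * (real n * (D + \<kappa>)) \<le> (ln D - ln (1 - D)) * fair_avg n (\<lambda>x. \<Sum>t<n. ?Z x t)"
    using d D by (intro mult_left_mono_neg) auto
  ultimately show ?thesis using le by (simp add: bin_entropy_def algebra_simps)
qed

section \<open>Correlation with functions of the messages\<close>

abbreviation total_avg :: "nat \<Rightarrow> (bool list \<Rightarrow> nat \<Rightarrow> real) \<Rightarrow> real" where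
  "total_avg n F \<equiv> fair_avg n (\<lambda>x. \<Sum>t<n. F x t)"

lemma total_avg_add: "total_avg n (\<lambda>x t. F x t + G x t) = total_avg n F + total_avg n G"
  by (simp add: sum.distrib fair_avg_add)

lemma total_avg_diff: "total_avg n (\<lambda>x t. F x t - G x t) = total_avg n F - total_avg n G"
  by (simp add: sum_subtractf fair_avg_diff)

lemma total_avg_cmult: "total_avg n (\<lambda>x t. c * F x t) = c * total_avg n F"
  by (simp add: sum_distrib_left[symmetric] fair_avg_cmult)

lemma total_avg_const: "total_avg n (\<lambda>x t. c) = real n * c"
  by simp

lemma total_avg_mono: "(\<And>x t. F x t \<le> G x t) \<Longrightarrow> total_avg n F \<le> total_avg n G"
  by (intro fair_avg_mono sum_mono)

text \<open>The constant is uniform down to \<open>D = 0\<close>, where \<open>ln 0 = 0\<close> makes its logarithms vanish.\<close>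
lemma error_correlation_le:
  fixes f :: "bool list \<Rightarrow> 'm" and g :: "'m \<Rightarrow> nat \<Rightarrow> bool"
  assumes T: "finite T" "\<And>x. x \<in> nlists n UNIV \<Longrightarrow> f x \<in> T"
    and D: "0 \<le> D" "D \<le> 1 / 2" and \<theta>: "0 < \<theta>" "\<theta> \<le> 1 / 2" and \<kappa>: "0 \<le> \<kappa>"
    and s: "\<And>m t. \<bar>s m t\<bar> \<le> 1"
    and d: "total_avg n (\<lambda>x t. hamming (x ! t) (g (f x) t)) \<le> real n * (D + \<kappa>)"
    and rate: "ln (card T) \<le> real n * (ln 2 - bin_entropy D + \<kappa>)"
  shows "total_avg n (\<lambda>x t. s (f x) t * (hamming (x ! t) (g (f x) t) - D))
    \<le> real n * (2 * \<theta> + \<kappa> * (1 + ln (1 - D) - ln D) / \<theta>)"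
proof (cases "D = 0")
  case True
  have "total_avg n (\<lambda>x t. s (f x) t * (hamming (x ! t) (g (f x) t) - D))
      \<le> total_avg n (\<lambda>x t. hamming (x ! t) (g (f x) t))"
  proof (rule total_avg_mono)
    fix x t
    show "s (f x) t * (hamming (x ! t) (g (f x) t) - D) \<le> hamming (x ! t) (g (f x) t)"
      using s[of "f x" t] True by (auto simp: hamming_def abs_le_iff)
  qed
  also have "\<dots> \<le> real n * \<kappa>" using d True by simp
  also have "\<dots> \<le> real n * (2 * \<theta> + \<kappa> / \<theta>)"
  proof (intro mult_left_mono)
    have "\<kappa> * 1 \<le> \<kappa> * (1 / \<theta>)" using \<theta> \<kappa> by (intro mult_left_mono) auto
    then show "\<kappa> \<le> 2 * \<theta> + \<kappa> / \<theta>" using \<theta> by simp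
  qed simp
  finally show ?thesis using True by simp
next
  case False
  let ?e = "total_avg n (\<lambda>x t. s (f x) t * (hamming (x ! t) (g (f x) t) - D))"
  have "\<theta> * ?e \<le> ln (card T) - real n * (ln 2 - bin_entropy D) + real n * \<kappa> * (ln (1 - D) - ln D) + 2 * real n * \<theta>\<^sup>2"
    using T D \<theta> s d False by (intro tilted_converse) auto
  also have "\<dots> \<le> real n * \<kappa> * (1 + ln (1 - D) - ln D) + 2 * real n * \<theta>\<^sup>2"
    using rate by (simp add: algebra_simps)
  finally have "?e \<le> (real n * \<kappa> * (1 + ln (1 - D) - ln D) + 2 * real n * \<theta>\<^sup>2) / \<theta>"
    using \<theta> by (simp add: field_simps)
  also have "\<dots> = real n * (2 * \<theta> + \<kappa> * (1 + ln (1 - D) - ln D) / \<theta>)"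
    using \<theta> by (simp add: field_simps power2_eq_square)
  finally show ?thesis .
qed

text \<open>The conditional expectation of the t-th source sign given the message; division by zero
  makes it 0 for a message that never occurs.\<close>

definition cond_mean :: "nat \<Rightarrow> (bool list \<Rightarrow> 'm) \<Rightarrow> 'm \<Rightarrow> nat \<Rightarrow> real" where
  "cond_mean n f m t = (\<Sum>x\<in>{x\<in>nlists n UNIV. f x = m}. pm (x ! t)) / card {x\<in>nlists n UNIV. f x = m}"

text \<open>The tower property, obtained by grouping source words by their message.\<close>

lemma fair_avg_cond_mean:
  "fair_avg n (\<lambda>x. F (f x) * cond_mean n f (f x) t) = fair_avg n (\<lambda>x. F (f x) * pm (x ! t))"
proof -
  let ?X = "nlists n (UNIV :: bool set)" and ?C = "\<lambda>m. {x\<in>nlists n UNIV. f x = m}"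
  have group: "(\<Sum>x\<in>?X. h x) = (\<Sum>m\<in>f ` ?X. \<Sum>x\<in>?C m. h x)" for h :: "bool list \<Rightarrow> real"
    by (rule sum.group[symmetric]) auto
  have "(\<Sum>x\<in>?C m. F (f x) * cond_mean n f (f x) t) = (\<Sum>x\<in>?C m. F (f x) * pm (x ! t))" if "m \<in> f ` ?X" for m
  proof -
    have "card (?C m) \<noteq> 0" using that by (auto simp: card_eq_0_iff)
    then show ?thesis
      by (simp add: cond_mean_def sum_distrib_left[symmetric])
  qed
  then show ?thesis
    unfolding fair_avg_def group by (simp cong: sum.cong)
qed

text \<open>The exponential moment of a fair sign. Only the quadratic order matters: after division
  by l the cost vanishes with l.\<close>

lemma cosh_le: "0 \<le> l \<Longrightarrow> l \<le> 1 \<Longrightarrow> exp l + exp (- l) \<le> 2 * exp (l\<^sup>2 :: real)"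
proof -
  assume l: "0 \<le> l" "l \<le> 1"
  have "exp (- l) \<le> 1 / (1 + l)"
    using exp_ge_add_one_self[of l] l by (simp add: exp_minus inverse_eq_divide frac_le)
  also have "\<dots> \<le> 1 - l + l\<^sup>2"
  proof -
    have "1 \<le> 1 + l ^ 3" using l by simp
    also have "\<dots> = (1 - l + l\<^sup>2) * (1 + l)" by (simp add: algebra_simps power2_eq_square power3_eq_cube)
    finally show ?thesis using l by (simp add: field_simps)
  qed
  finally have "exp l + exp (- l) \<le> 2 + 2 * l\<^sup>2"
    using exp_bound[OF l] by simp
  also have "\<dots> \<le> 2 * exp (l\<^sup>2)" using exp_ge_add_one_self[of "l\<^sup>2"] by linarith
  finally show ?thesis .
qed

text \<open>Jensen for \<open>exp\<close> through its tangent at the mean. It lets conditional means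
  inside an exponential be replaced by the source signs themselves; the factor \<open>card C\<close>
  makes the empty fibre harmless.\<close>

lemma card_mult_exp_mean_le:
  assumes "finite C"
  shows "real (card C) * exp ((\<Sum>x\<in>C. h x) / card C) \<le> (\<Sum>x\<in>C. exp (h x :: real))"
proof (cases "C = {}")
  case False
  define \<mu> where "\<mu> = (\<Sum>x\<in>C. h x) / card C"
  have c: "card C \<noteq> 0" using assms False by simp
  have "exp \<mu> * (1 + h x - \<mu>) \<le> exp (h x)" for x
  proof -
    have "exp \<mu> * (1 + (h x - \<mu>)) \<le> exp \<mu> * exp (h x - \<mu>)"
      by (intro mult_left_mono exp_ge_add_one_self) simp
    then show ?thesis by (simp add: exp_add[symmetric] add_diff_eq)
  qed
  then have "(\<Sum>x\<in>C. exp \<mu> * (1 + h x - \<mu>)) \<le> (\<Sum>x\<in>C. exp (h x))" by (rule sum_mono)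
  also have "(\<Sum>x\<in>C. exp \<mu> * (1 + h x - \<mu>)) = exp \<mu> * (real (card C) + (\<Sum>x\<in>C. h x) - real (card C) * \<mu>)"
    by (simp add: sum_distrib_left[symmetric] sum.distrib sum_subtractf)
  also have "\<dots> = real (card C) * exp \<mu>" using c by (simp add: \<mu>_def)
  finally show ?thesis by (simp add: \<mu>_def)
qed simp

text \<open>If the sum rate is nearly optimal, the messages are nearly independent; since the source is
  uniform, \<open>\<Sum>t. cond_mean t * b t\<close> is subgaussian when \<open>b\<close> is independent of the first message,
  and the change of measure costs only the (small) mutual information of the messages.\<close>
lemma message_correlation_le:
  fixes f1 :: "bool list \<Rightarrow> 'm" and f2 :: "bool list \<Rightarrow> 'k" and g :: "'m \<Rightarrow> 'k \<Rightarrow> nat \<Rightarrow> bool"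
    and b :: "'k \<Rightarrow> nat \<Rightarrow> bool"
  assumes T1: "finite T1" "\<And>x. x \<in> nlists n UNIV \<Longrightarrow> f1 x \<in> T1"
    and T2: "finite T2" "\<And>x. x \<in> nlists n UNIV \<Longrightarrow> f2 x \<in> T2"
    and D: "0 < D" "D \<le> 1 / 2" and l: "0 \<le> l" "l \<le> 1"
    and d: "total_avg n (\<lambda>x t. hamming (x ! t) (g (f1 x) (f2 x) t)) \<le> real n * D"
  shows "l * total_avg n (\<lambda>x t. cond_mean n f1 (f1 x) t * pm (b (f2 x) t))
    \<le> ln (card T1) + ln (card T2) - real n * (ln 2 - bin_entropy D) + real n * l\<^sup>2"
proof -
  let ?X = "nlists n (UNIV :: bool set)" and ?C = "\<lambda>m. {x\<in>nlists n UNIV. f1 x = m}"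
  define N where "N m = real (card (?C m))" for m
  define \<phi> where "\<phi> m k = l * (\<Sum>t<n. cond_mean n f1 m t * pm (b k t))" for m k
  define q where "q m k t c = (if c = g m k t then 1 - D else D)" for m k t c
  define B where "B m k x = (\<Prod>t<n. q m k t (x ! t))" for m k x
  \<comment> \<open>Weighting by \<open>N\<close>, which is \<open>2 ^ n\<close> times the
    probability of the first message, makes the sum over messages charge only
    \<open>card T2\<close>. The rate of the first message returns through
    \<open>lnN\<close>.\<close>
  define K where "K x = N (f1 x) * exp (\<phi> (f1 x) (f2 x)) * B (f1 x) (f2 x) x" for x
  have qpos: "0 < q m k t c" for m k t c using D by (simp add: q_def)
  have q0: "q m k t c \<noteq> 0" for m k t c using D by (simp add: q_def)
  have q1: "q m k t True + q m k t False = 1" for m k t by (simp add: q_def)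
  have Bpos: "0 < B m k x" for m k x unfolding B_def by (intro prod_pos) (simp add: qpos)
  have Npos: "0 < N (f1 x)" if "x \<in> ?X" for x
    using that by (auto simp: N_def card_gt_0_iff)
  have N0: "0 \<le> N m" for m by (simp add: N_def)
  obtain x0 where x0: "x0 \<in> ?X" using nlists_not_empty by blast
  have Tpos: "0 < card T1" "0 < card T2" using T1 T2 x0 card_gt_0_iff by blast+
  have group: "(\<Sum>x\<in>?X. h x) = (\<Sum>m\<in>T1. \<Sum>x\<in>?C m. h x)" for h :: "bool list \<Rightarrow> real"
    by (rule sum.group[symmetric]) (use T1 in auto)
  \<comment> \<open>For a fixed second message the signs of b are constants. Jensen on each fibre of
    \<open>f1\<close> removes the conditional mean, and the fibres reassemble into the uniform
    source, whose signs are independent.\<close>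
  have moment: "(\<Sum>m\<in>T1. N m * exp (\<phi> m k)) \<le> 2 ^ n * exp (real n * l\<^sup>2)" for k
  proof -
    have "N m * exp (\<phi> m k) \<le> (\<Sum>x\<in>?C m. exp (l * (\<Sum>t<n. pm (x ! t) * pm (b k t))))" for m
    proof -
      have "\<phi> m k = (\<Sum>x\<in>?C m. l * (\<Sum>t<n. pm (x ! t) * pm (b k t))) / card (?C m)"
        unfolding sum_distrib_left[symmetric] sum.swap[of _ "{..<n}" "?C m"]
        by (simp add: \<phi>_def cond_mean_def sum_distrib_right[symmetric] sum_divide_distrib[symmetric])
      then show ?thesis
        unfolding N_def by (simp only:) (rule card_mult_exp_mean_le, simp)
    qed
    then have "(\<Sum>m\<in>T1. N m * exp (\<phi> m k)) \<le> (\<Sum>m\<in>T1. \<Sum>x\<in>?C m. exp (l * (\<Sum>t<n. pm (x ! t) * pm (b k t))))"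
      by (rule sum_mono)
    also have "\<dots> = (\<Sum>x\<in>?X. \<Prod>t<n. exp (l * (pm (x ! t) * pm (b k t))))"
      unfolding group by (simp add: exp_sum sum_distrib_left)
    also have "\<dots> = (\<Prod>t<n. exp (l * (pm True * pm (b k t))) + exp (l * (pm False * pm (b k t))))"
      by (rule sum_nlists_bool_prod)
    also have "\<dots> \<le> (\<Prod>t<n. 2 * exp (l\<^sup>2))"
      using cosh_le[OF l] by (intro prod_mono) (auto simp: pm_def add.commute)
    also have "\<dots> = 2 ^ n * exp (real n * l\<^sup>2)"
      by (simp add: power_mult_distrib exp_of_nat_mult)
    finally show ?thesis .
  qed
  have "fair_avg n K \<le> real (card T2) * exp (real n * l\<^sup>2)"
  proof -
    have "(\<Sum>x\<in>?X. K x) \<le> (\<Sum>mk\<in>T1 \<times> T2. \<Sum>x\<in>?X. N (fst mk) * exp (\<phi> (fst mk) (snd mk)) * B (fst mk) (snd mk) x)"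
      using sum_fibre_le[of ?X "T1 \<times> T2" "\<lambda>x. (f1 x, f2 x)"
          "\<lambda>mk x. N (fst mk) * exp (\<phi> (fst mk) (snd mk)) * B (fst mk) (snd mk) x"]
        T1 T2 N0 Bpos by (simp add: K_def less_imp_le)
    also have "\<dots> = (\<Sum>mk\<in>T1 \<times> T2. N (fst mk) * exp (\<phi> (fst mk) (snd mk)))"
      unfolding sum_distrib_left[symmetric] B_def sum_nlists_bool_prod by (simp add: q1)
    also have "\<dots> = (\<Sum>k\<in>T2. \<Sum>m\<in>T1. N m * exp (\<phi> m k))"
      by (subst sum.swap) (simp add: sum.cartesian_product case_prod_beta)
    also have "\<dots> \<le> (\<Sum>k\<in>T2. 2 ^ n * exp (real n * l\<^sup>2))"
      by (intro sum_mono moment)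
    finally show ?thesis
      by (simp add: fair_avg_def field_simps)
  qed
  then have upper: "fair_avg n (\<lambda>x. ln (K x)) \<le> ln (real (card T2) * exp (real n * l\<^sup>2))"
    using Npos Bpos Tpos by (intro fair_avg_ln_le[where K = K]) (auto simp: K_def)
  \<comment> \<open>The entropy of the first message is at most \<open>ln (card T1)\<close>.\<close>
  have lnN: "fair_avg n (\<lambda>x. ln (1 / N (f1 x))) \<le> ln (real (card T1) / 2 ^ n)"
  proof (rule fair_avg_ln_le)
    have "(\<Sum>x\<in>?X. 1 / N (f1 x)) = (\<Sum>m\<in>T1. \<Sum>x\<in>?C m. 1 / N m)"
      unfolding group by (intro sum.cong refl) auto
    also have "\<dots> \<le> (\<Sum>m\<in>T1. 1)"
      by (intro sum_mono) (simp add: N_def)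
    finally show "fair_avg n (\<lambda>x. 1 / N (f1 x)) \<le> real (card T1) / 2 ^ n"
      unfolding fair_avg_def by (intro divide_right_mono) auto
  qed (use Npos Tpos in auto)
  have lnB: "ln (B m k x) = real n * ln (1 - D) + (ln D - ln (1 - D)) * (\<Sum>t<n. hamming (x ! t) (g m k t))" for m k x
  proof -
    have "ln (B m k x) = (\<Sum>t<n. ln (q m k t (x ! t)))"
      unfolding B_def by (intro ln_prod) (simp_all add: q0)
    also have "\<dots> = (\<Sum>t<n. ln (1 - D) + (ln D - ln (1 - D)) * hamming (x ! t) (g m k t))"
      by (intro sum.cong refl) (auto simp: q_def hamming_def)
    finally show ?thesis by (simp add: sum.distrib sum_distrib_left)
  qed
  have "fair_avg n (\<lambda>x. ln (K x)) = fair_avg n (\<lambda>x. (real n * ln (1 - D) - ln (1 / N (f1 x)))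
      + (\<phi> (f1 x) (f2 x) + (ln D - ln (1 - D)) * (\<Sum>t<n. hamming (x ! t) (g (f1 x) (f2 x) t))))"
  proof (rule fair_avg_cong)
    fix x assume x: "x \<in> ?X"
    have "ln (K x) = ln (N (f1 x)) + \<phi> (f1 x) (f2 x) + ln (B (f1 x) (f2 x) x)"
      using Npos[OF x] Bpos by (simp add: K_def ln_mult_pos)
    then show "ln (K x) = (real n * ln (1 - D) - ln (1 / N (f1 x)))
      + (\<phi> (f1 x) (f2 x) + (ln D - ln (1 - D)) * (\<Sum>t<n. hamming (x ! t) (g (f1 x) (f2 x) t)))"
      using Npos[OF x] by (simp add: lnB ln_div)
  qed
  also have "\<dots> = real n * ln (1 - D) - fair_avg n (\<lambda>x. ln (1 / N (f1 x)))
      + l * total_avg n (\<lambda>x t. cond_mean n f1 (f1 x) t * pm (b (f2 x) t))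
      + (ln D - ln (1 - D)) * total_avg n (\<lambda>x t. hamming (x ! t) (g (f1 x) (f2 x) t))"
    by (simp only: fair_avg_add fair_avg_diff fair_avg_const fair_avg_cmult \<phi>_def)
  finally have eq: "fair_avg n (\<lambda>x. ln (K x)) = \<dots>" .
  have "(ln D - ln (1 - D)) * (real n * D) \<le> (ln D - ln (1 - D)) * total_avg n (\<lambda>x t. hamming (x ! t) (g (f1 x) (f2 x) t))"
    using d D by (intro mult_left_mono_neg) auto
  then show ?thesis
    using upper lnN Tpos unfolding eq
    by (simp add: ln_mult_pos ln_div ln_realpow bin_entropy_def algebra_simps)
qed

section \<open>The second distortion of a single code\<close>

lemma fair_avg_sum: "fair_avg n (\<lambda>x. \<Sum>t<k. F x t) = (\<Sum>t<k. fair_avg n (\<lambda>x. F x t))"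
  unfolding fair_avg_def sum_divide_distrib[symmetric] by (simp only: sum.swap[of _ "{..<k}"])

text \<open>The per-letter bound of \<open>error_correlation_le\<close>: 2 \<theta> is the quadratic
  cost of the tilt, the rest is the slack in rate and distortion divided by its strength.\<close>

definition corr_slack :: "real \<Rightarrow> real \<Rightarrow> real \<Rightarrow> real" where
  "corr_slack D \<kappa> \<theta> = 2 * \<theta> + \<kappa> * (1 + ln (1 - D) - ln D) / \<theta>"

lemma ln_odds_nonneg: "0 \<le> D \<Longrightarrow> D \<le> 1 / 2 \<Longrightarrow> 0 \<le> ln (1 - D) - ln (D :: real)"
  by (cases "D = 0") auto

lemma corr_slack_nonneg: "0 \<le> D \<Longrightarrow> D \<le> 1 / 2 \<Longrightarrow> 0 \<le> \<kappa> \<Longrightarrow> 0 < \<theta> \<Longrightarrow> 0 \<le> corr_slack D \<kappa> \<theta>"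
  using ln_odds_nonneg[of D] by (simp add: corr_slack_def)

lemma total_avg_hamming: "total_avg n (\<lambda>x t. pm (x ! t) * pm (y x t)) = real n - 2 * total_avg n (\<lambda>x t. hamming (x ! t) (y x t))"
proof -
  have "total_avg n (\<lambda>x t. pm (x ! t) * pm (y x t)) = total_avg n (\<lambda>x t. 1 - 2 * hamming (x ! t) (y x t))"
    by (intro fair_avg_cong sum.cong refl) (simp add: hamming_def pm_def)
  then show ?thesis by (simp only: total_avg_diff total_avg_cmult total_avg_const)
qed

text \<open>Collects what concerns the pair of messages, so that it also serves the case D1 = 1/2.
  The constraints on the first description alone are added in \<open>second_dist_ge\<close>.\<close>

locale md_code =
  fixes n :: nat and f1 :: "bool list \<Rightarrow> 'm" and f2 :: "bool list \<Rightarrow> 'k" and T1 :: "'m set" and T2 :: "'k set"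
    and g2 :: "'k \<Rightarrow> nat \<Rightarrow> bool" and g12 :: "'m \<Rightarrow> 'k \<Rightarrow> nat \<Rightarrow> bool" and D12 \<kappa> \<theta> :: real
  assumes T1: "finite T1" "\<And>x. x \<in> nlists n UNIV \<Longrightarrow> f1 x \<in> T1"
    and T2: "finite T2" "\<And>x. x \<in> nlists n UNIV \<Longrightarrow> f2 x \<in> T2"
    and D12: "0 \<le> D12" "D12 \<le> 1 / 2" and \<theta>: "0 < \<theta>" "\<theta> \<le> 1 / 2" and \<kappa>: "0 < \<kappa>"
    and d12: "total_avg n (\<lambda>x t. hamming (x ! t) (g12 (f1 x) (f2 x) t)) \<le> real n * (D12 + \<kappa>)"
    and rate12: "ln (card T1) + ln (card T2) \<le> real n * (ln 2 - bin_entropy D12 + \<kappa>)"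
begin

lemma card_pos: "0 < card T1" "0 < card T2"
proof -
  obtain x :: "bool list" where "x \<in> nlists n UNIV" using nlists_not_empty by blast
  then show "0 < card T1" "0 < card T2" using T1 T2 card_gt_0_iff by blast+
qed

abbreviation "c x t \<equiv> pm (g12 (f1 x) (f2 x) t)"

text \<open>With Z the error of the joint decoder, x = (1 - 2 Z) c, so E[x y] = (1 - 2 D12) E[c y] -
  2 E[c y (Z - D12)]. The last term is controlled by treating the two messages as one and testing
  with the sign - c y.\<close>

lemma corr_via_joint:
  "total_avg n (\<lambda>x t. pm (x ! t) * pm (y (f1 x) (f2 x) t))
    \<le> (1 - 2 * D12) * total_avg n (\<lambda>x t. c x t * pm (y (f1 x) (f2 x) t)) + 2 * (real n * corr_slack D12 \<kappa> \<theta>)"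
proof -
  let ?s = "\<lambda>m t. - (pm (g12 (fst m) (snd m) t) * pm (y (fst m) (snd m) t))"
  let ?e = "total_avg n (\<lambda>x t. ?s (f1 x, f2 x) t * (hamming (x ! t) (g12 (f1 x) (f2 x) t) - D12))"
  have "total_avg n (\<lambda>x t. pm (x ! t) * pm (y (f1 x) (f2 x) t))
      = total_avg n (\<lambda>x t. (1 - 2 * D12) * (c x t * pm (y (f1 x) (f2 x) t))
        + 2 * (?s (f1 x, f2 x) t * (hamming (x ! t) (g12 (f1 x) (f2 x) t) - D12)))"
    by (intro fair_avg_cong sum.cong refl) (simp add: hamming_def pm_def algebra_simps)
  also have "\<dots> = (1 - 2 * D12) * total_avg n (\<lambda>x t. c x t * pm (y (f1 x) (f2 x) t)) + 2 * ?e"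
    by (simp only: total_avg_add total_avg_cmult)
  finally have eq: "total_avg n (\<lambda>x t. pm (x ! t) * pm (y (f1 x) (f2 x) t)) = \<dots>" .
  have rate: "ln (real (card (T1 \<times> T2))) \<le> real n * (ln 2 - bin_entropy D12 + \<kappa>)"
    using rate12 card_pos by (simp only: card_cartesian_product of_nat_mult ln_mult_pos of_nat_0_less_iff)
  have "?e \<le> real n * corr_slack D12 \<kappa> \<theta>"
    unfolding corr_slack_def
    using error_correlation_le[where T = "T1 \<times> T2" and f = "\<lambda>x. (f1 x, f2 x)" and s = ?s and g = "\<lambda>m. g12 (fst m) (snd m)",
        OF _ _ D12 \<theta> less_imp_le[OF \<kappa>] _ _ rate] T1 T2 d12
    by (simp add: abs_mult)
  then show ?thesis unfolding eq by simp
qed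

text \<open>Meant for D1 = 1/2, where the claimed bound on the second distortion is D12. It is
  \<open>corr_via_joint\<close> with c b \<le> 1.\<close>

lemma second_dist_ge_joint:
  "real n * D12 \<le> total_avg n (\<lambda>x t. hamming (x ! t) (g2 (f2 x) t)) + real n * corr_slack D12 \<kappa> \<theta>"
proof -
  have "total_avg n (\<lambda>x t. c x t * pm (g2 (f2 x) t)) \<le> total_avg n (\<lambda>x t. 1)"
    by (rule total_avg_mono) (simp add: pm_def)
  also have "\<dots> = real n" by simp
  finally have "(1 - 2 * D12) * total_avg n (\<lambda>x t. c x t * pm (g2 (f2 x) t)) \<le> (1 - 2 * D12) * real n"
    using D12 by (intro mult_left_mono) auto
  then show ?thesis
    using corr_via_joint[of "\<lambda>m. g2"] unfolding total_avg_hamming by (simp add: algebra_simps)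
qed

text \<open>Multiplying the averaged sign inequality by 1 - 2 D12 lets \<open>corr_via_joint\<close>
  exchange c for x in the terms with a and b, and E[x a] is about 1 - 2 D1 or more by the first
  distortion. The term in a b is compared with E[x | first message] b, at the price of dividing by 1
  - 2 D1.\<close>

lemma second_dist_ge:
  assumes D1: "D12 \<le> D1" "D1 < 1 / 2" and \<kappa>': "D12 + \<kappa> \<le> 1 / 2"
    and d1: "total_avg n (\<lambda>x t. hamming (x ! t) (g1 (f1 x) t)) \<le> real n * (D1 + \<kappa>)"
    and rate1: "ln (card T1) \<le> real n * (ln 2 - bin_entropy D1 + \<kappa>)"
  shows "real n * (1 / 2 + D12 - D1) \<le> total_avg n (\<lambda>x t. hamming (x ! t) (g2 (f2 x) t))
    + real n * (((\<kappa> + bin_entropy (D12 + \<kappa>) - bin_entropy D12) / \<theta> + \<theta> + 2 * corr_slack D1 \<kappa> \<theta>) / (2 * (1 - 2 * D1))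
      + \<kappa> + 2 * corr_slack D12 \<kappa> \<theta>)"
proof -
  let ?a = "\<lambda>x t. pm (g1 (f1 x) t)" and ?b = "\<lambda>x t. pm (g2 (f2 x) t)" and ?m = "\<lambda>x. cond_mean n f1 (f1 x)"
  define Y where "Y = (\<kappa> + bin_entropy (D12 + \<kappa>) - bin_entropy D12) / \<theta> + \<theta> + 2 * corr_slack D1 \<kappa> \<theta>"
  have Y0: "0 \<le> Y"
    using bin_entropy_mono[of D12 "D12 + \<kappa>"] corr_slack_nonneg[of D1 \<kappa> \<theta>] D12 D1 \<kappa> \<kappa>' \<theta>
    by (auto simp: Y_def intro!: add_nonneg_nonneg divide_nonneg_nonneg)
  \<comment> \<open>\<open>message_correlation_le\<close> takes a positive distortion level that the
    code meets exactly, so it is applied at D12 + \<kappa>; hence the entropy increment.\<close>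
  have mb: "total_avg n (\<lambda>x t. ?m x t * ?b x t) \<le> real n * ((\<kappa> + bin_entropy (D12 + \<kappa>) - bin_entropy D12) / \<theta> + \<theta>)"
  proof -
    have "\<theta> * total_avg n (\<lambda>x t. ?m x t * ?b x t) \<le> ln (card T1) + ln (card T2) - real n * (ln 2 - bin_entropy (D12 + \<kappa>)) + real n * \<theta>\<^sup>2"
      using T1 T2 D12 \<kappa> \<kappa>' \<theta> d12 by (intro message_correlation_le) auto
    also have "\<dots> \<le> real n * (\<kappa> + bin_entropy (D12 + \<kappa>) - bin_entropy D12 + \<theta>\<^sup>2)"
      using rate12 by (simp add: algebra_simps)
    finally have "total_avg n (\<lambda>x t. ?m x t * ?b x t) \<le> real n * (\<kappa> + bin_entropy (D12 + \<kappa>) - bin_entropy D12 + \<theta>\<^sup>2) / \<theta>"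
      using \<theta> by (simp add: field_simps)
    also have "\<dots> = real n * ((\<kappa> + bin_entropy (D12 + \<kappa>) - bin_entropy D12) / \<theta> + \<theta>)"
      using \<theta> by (simp add: field_simps power2_eq_square)
    finally show ?thesis .
  qed
  \<comment> \<open>This sign turns the deviation into its absolute value. It depends on the first
    message alone, so the conditional mean may be exchanged for the source sign and
    \<open>error_correlation_le\<close> applies with the test function - s a.\<close>
  define s where "s m t = sgn (cond_mean n f1 m t - (1 - 2 * D1) * pm (g1 m t))" for m t
  have s1: "\<bar>s m t\<bar> \<le> 1" for m t by (simp add: s_def sgn_if)
  have ma: "total_avg n (\<lambda>x t. \<bar>?m x t - (1 - 2 * D1) * ?a x t\<bar>) \<le> 2 * (real n * corr_slack D1 \<kappa> \<theta>)"
  proof -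
    have "total_avg n (\<lambda>x t. \<bar>?m x t - (1 - 2 * D1) * ?a x t\<bar>)
        = total_avg n (\<lambda>x t. s (f1 x) t * ?m x t - (1 - 2 * D1) * (s (f1 x) t * ?a x t))"
      by (intro fair_avg_cong sum.cong refl) (simp add: s_def abs_sgn algebra_simps)
    also have "\<dots> = total_avg n (\<lambda>x t. s (f1 x) t * ?m x t) - (1 - 2 * D1) * total_avg n (\<lambda>x t. s (f1 x) t * ?a x t)"
      by (simp only: total_avg_diff total_avg_cmult)
    also have "total_avg n (\<lambda>x t. s (f1 x) t * ?m x t) = total_avg n (\<lambda>x t. s (f1 x) t * pm (x ! t))"
      unfolding fair_avg_sum by (intro sum.cong refl fair_avg_cond_mean)
    also have "total_avg n (\<lambda>x t. s (f1 x) t * pm (x ! t)) - (1 - 2 * D1) * total_avg n (\<lambda>x t. s (f1 x) t * ?a x t)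
        = total_avg n (\<lambda>x t. s (f1 x) t * pm (x ! t) - (1 - 2 * D1) * (s (f1 x) t * ?a x t))"
      by (simp only: total_avg_diff total_avg_cmult)
    also have "\<dots> = total_avg n (\<lambda>x t. 2 * ((- s (f1 x) t * ?a x t) * (hamming (x ! t) (g1 (f1 x) t) - D1)))"
      by (intro fair_avg_cong sum.cong refl) (simp add: hamming_def pm_def algebra_simps)
    also have "\<dots> = 2 * total_avg n (\<lambda>x t. (- s (f1 x) t * ?a x t) * (hamming (x ! t) (g1 (f1 x) t) - D1))"
      by (rule total_avg_cmult)
    also have "\<dots> \<le> 2 * (real n * corr_slack D1 \<kappa> \<theta>)"
      unfolding corr_slack_def
      using error_correlation_le[of T1 n f1 D1 \<theta> \<kappa> "\<lambda>m t. - s m t * pm (g1 m t)" g1] T1 D12 D1 \<theta> \<kappa> d1 rate1 s1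
      by (simp add: abs_mult)
    finally show ?thesis .
  qed
  have ab: "(1 - 2 * D1) * total_avg n (\<lambda>x t. ?a x t * ?b x t) \<le> real n * Y"
  proof -
    have "(1 - 2 * D1) * total_avg n (\<lambda>x t. ?a x t * ?b x t) = total_avg n (\<lambda>x t. (1 - 2 * D1) * (?a x t * ?b x t))"
      by (rule total_avg_cmult[symmetric])
    also have "\<dots> \<le> total_avg n (\<lambda>x t. ?m x t * ?b x t + \<bar>?m x t - (1 - 2 * D1) * ?a x t\<bar>)"
    proof (rule total_avg_mono)
      fix x t
      show "(1 - 2 * D1) * (?a x t * ?b x t) \<le> ?m x t * ?b x t + \<bar>?m x t - (1 - 2 * D1) * ?a x t\<bar>"
      proof -
        define z where "z = (1 - 2 * D1) * ?a x t"
        have "z * ?b x t \<le> ?m x t * ?b x t + \<bar>?m x t - z\<bar>"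
          by (cases "g2 (f2 x) t") (auto simp: pm_def)
        then show ?thesis by (simp add: z_def mult.assoc)
      qed
    qed
    also have "\<dots> = total_avg n (\<lambda>x t. ?m x t * ?b x t) + total_avg n (\<lambda>x t. \<bar>?m x t - (1 - 2 * D1) * ?a x t\<bar>)"
      by (rule total_avg_add)
    also have "\<dots> \<le> real n * Y" using mb ma by (simp add: Y_def algebra_simps)
    finally show ?thesis .
  qed
  define y where "y = total_avg n (\<lambda>x t. ?a x t * ?b x t)"
  have ab': "(1 - 2 * D12) * y \<le> real n * Y / (1 - 2 * D1)"
  proof (cases "0 \<le> y")
    case True
    then have "(1 - 2 * D12) * y \<le> 1 * y" using D12 by (intro mult_right_mono) auto
    also have "y \<le> real n * Y / (1 - 2 * D1)" using ab D1 by (simp add: y_def field_simps)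
    finally show ?thesis by simp
  next
    case False
    then have "(1 - 2 * D12) * y \<le> 0" using D12 by (intro mult_nonneg_nonpos) auto
    also have "0 \<le> real n * Y / (1 - 2 * D1)" using Y0 D1 by simp
    finally show ?thesis .
  qed
  \<comment> \<open>For a = b the sign inequality reads 2 c a \<le> 2; for a = - b both sides
    vanish.\<close>
  have "total_avg n (\<lambda>x t. c x t * ?b x t) \<le> total_avg n (\<lambda>x t. 1 + ?a x t * ?b x t - c x t * ?a x t)"
    by (rule total_avg_mono) (auto simp: pm_def)
  also have "\<dots> = real n + y - total_avg n (\<lambda>x t. c x t * ?a x t)"
    by (simp only: total_avg_add total_avg_diff total_avg_const y_def)
  finally have cb: "(1 - 2 * D12) * total_avg n (\<lambda>x t. c x t * ?b x t)
      \<le> (1 - 2 * D12) * (real n + y - total_avg n (\<lambda>x t. c x t * ?a x t))"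
    using D12 by (intro mult_left_mono) auto
  have xa: "real n - 2 * (real n * (D1 + \<kappa>)) \<le> total_avg n (\<lambda>x t. pm (x ! t) * ?a x t)"
    using d1 unfolding total_avg_hamming by simp
  have "real n - 2 * total_avg n (\<lambda>x t. hamming (x ! t) (g2 (f2 x) t))
      \<le> real n * (2 * D1 - 2 * D12) + real n * Y / (1 - 2 * D1) + 2 * real n * \<kappa> + 4 * (real n * corr_slack D12 \<kappa> \<theta>)"
    using corr_via_joint[of "\<lambda>m. g2"] corr_via_joint[of "\<lambda>m k. g1 m"] cb xa ab'
    unfolding total_avg_hamming[of n "\<lambda>x t. g2 (f2 x) t"] by (simp add: algebra_simps)
  moreover have "real n * Y / (1 - 2 * D1) = 2 * (real n * (Y / (2 * (1 - 2 * D1))))"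
    using D1 by (simp add: field_simps)
  moreover have "N * (1 / 2 + D12 - D1) \<le> A + N * (w + k + 2 * S)"
    if "N - 2 * A \<le> N * (2 * D1 - 2 * D12) + 2 * (N * w) + 2 * N * k + 4 * (N * S)" for N A w k S :: real
    using that by (simp add: algebra_simps)
  ultimately show ?thesis
    unfolding Y_def[symmetric] by simp
qed

end

section \<open>Sum rate and second distortion\<close>

lemma exp_dist_total_avg:
  "0 < n \<Longrightarrow> exp_dist bss hamming n g \<le> r \<longleftrightarrow> total_avg n (\<lambda>x t. hamming (x ! t) (g x t)) \<le> real n * r"
proof -
  assume "0 < n"
  moreover have "exp_dist bss hamming n g = total_avg n (\<lambda>x t. hamming (x ! t) (g x t)) / real n"
    by (simp add: exp_dist_bss fair_avg_def sum_divide_distrib mult.commute)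
  ultimately show ?thesis by (simp add: pos_divide_le_eq mult.commute)
qed

lemma ln_rate_le:
  assumes "log 2 (real M) / real n \<le> R" "0 < n"
  shows "ln (real M) \<le> real n * (R * ln 2)"
proof -
  have "ln (real M) / ln 2 \<le> R * real n"
    using assms by (simp add: log_def field_simps)
  then show ?thesis by (simp add: field_simps)
qed

text \<open>The point-to-point converse for the pair of messages: \<open>tilted_converse\<close>
  with \<theta> = 0. The other two distortions are arbitrary, so scalable codes are covered.\<close>

lemma bss_sum_rate_ge:
  assumes D12: "0 \<le> D12" "D12 \<le> 1 / 2"
    and ach: "md_achievable bss hamming R1 R2 D1 D2 (ereal D12)"
  shows "1 - bin_entropy D12 / ln 2 \<le> R1 + R2"
proof (rule field_le_epsilon)
  fix e :: real assume e: "0 < e"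
  then have "0 < e / 2 * ln 2" by simp
  then obtain \<delta> where \<delta>: "0 < \<delta>" "\<And>y. \<bar>y - D12\<bar> < \<delta> \<Longrightarrow> \<bar>bin_entropy y - bin_entropy D12\<bar> < e / 2 * ln 2"
    by (rule bin_entropy_eps_delta[where x = D12]) blast
  \<comment> \<open>D12 + eps must stay within 1/2 and in the continuity window. At D12 = 1/2 there
    is no such room, but there the bound is 0, which follows from the message sets being
    nonempty.\<close>
  define eps where "eps = (if D12 = 1 / 2 then e / 4 else min (e / 4) (min (\<delta> / 2) (1 / 2 - D12)))"
  have eps: "0 < eps" "eps \<le> e / 4"
    using e \<delta> D12 by (auto simp: eps_def simp del: le_divide_eq_numeral1)
  obtain N where N: "\<And>n. n \<ge> N \<Longrightarrow> \<exists>M1 M2 f1 f2 g1 g2 g12.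
      md_code_ok bss hamming R1 R2 D1 D2 (ereal D12) eps n M1 M2 f1 f2 g1 g2 g12"
    using ach eps unfolding md_achievable_def by blast
  define n where "n = Suc N"
  have n: "0 < n" by (simp add: n_def)
  obtain M1 M2 f1 f2 g1 g2 g12 where code: "md_code_ok bss hamming R1 R2 D1 D2 (ereal D12) eps n M1 M2 f1 f2 g1 g2 g12"
    using N[of n] by (auto simp: n_def)
  have f: "f1 x < M1" "f2 x < M2" if "x \<in> nlists n UNIV" for x
    using code that by (auto simp: md_code_ok_def)
  have M: "0 < M1" "0 < M2"
    using f nlists_not_empty[of UNIV n] by (metis UNIV_not_empty not_less_zero gr0I)+
  have "log 2 (real M1) / real n \<le> R1 + eps" "log 2 (real M2) / real n \<le> R2 + eps"
    using code by (simp_all add: md_code_ok_def)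
  note this[THEN ln_rate_le[OF _ n]]
  then have rate: "ln (real M1) + ln (real M2) \<le> real n * ((R1 + R2 + 2 * eps) * ln 2)"
    by (simp add: algebra_simps)
  have "1 - bin_entropy D12 / ln 2 - e / 2 \<le> R1 + R2 + 2 * eps"
  proof (cases "D12 = 1 / 2")
    case True
    have "0 \<le> ln (real M1) + ln (real M2)" using M by simp
    then have "0 \<le> real n * ((R1 + R2 + 2 * eps) * ln 2)" using rate by linarith
    then have "0 \<le> R1 + R2 + 2 * eps" using n by (simp add: zero_le_mult_iff)
    then show ?thesis unfolding True bin_entropy_half using e by simp
  next
    case False
    then have D': "0 < D12 + eps" "D12 + eps \<le> 1 / 2" "\<bar>(D12 + eps) - D12\<bar> < \<delta>"
    proof -
      have "eps \<le> \<delta> / 2" "eps \<le> 1 / 2 - D12"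
        using False by (simp_all only: eps_def if_False min_le_iff_disj order_refl simp_thms)
      then show "0 < D12 + eps" "D12 + eps \<le> 1 / 2" "\<bar>(D12 + eps) - D12\<bar> < \<delta>"
        using eps \<delta> D12 by auto
    qed
    have "total_avg n (\<lambda>x t. hamming (x ! t) (g12 (f1 x) (f2 x) t)) \<le> real n * (D12 + eps)"
      using code n by (simp add: md_code_ok_def exp_dist_total_avg)
    then have "real n * (ln 2 - bin_entropy (D12 + eps)) \<le> ln (card ({..<M1} \<times> {..<M2}))"
      using tilted_converse[of "{..<M1} \<times> {..<M2}" n "\<lambda>x. (f1 x, f2 x)" "D12 + eps" 0 "\<lambda>_ _. 0" "\<lambda>m. g12 (fst m) (snd m)" 0]
        f D' by simp
    also have "\<dots> \<le> real n * ((R1 + R2 + 2 * eps) * ln 2)"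
      using rate M by (simp add: ln_mult_pos)
    finally have "ln 2 - bin_entropy (D12 + eps) \<le> (R1 + R2 + 2 * eps) * ln 2"
      using n by simp
    moreover have "bin_entropy (D12 + eps) < bin_entropy D12 + e / 2 * ln 2"
      using \<delta>(2)[OF D'(3)] by linarith
    moreover have "(1 - bin_entropy D12 / ln 2 - e / 2) * ln 2 = ln 2 - bin_entropy D12 - e / 2 * ln 2"
      by (simp add: left_diff_distrib)
    ultimately have "(1 - bin_entropy D12 / ln 2 - e / 2) * ln 2 \<le> (R1 + R2 + 2 * eps) * ln 2"
      by linarith
    then show ?thesis by simp
  qed
  then show "1 - bin_entropy D12 / ln 2 \<le> R1 + R2 + e" using eps by linarith
qed

text \<open>Successive refinability: the codes of \<open>bss_md_achievable\<close>, with the second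
  distortion ignored, already attain the point-to-point bound for the pair of messages.\<close>

lemma sc_sum_rate_bss:
  assumes "0 \<le> D12" "D12 \<le> D1" "D1 \<le> 1 / 2"
  shows "sc_sum_rate bss hamming (rate_dist bss hamming D1) (ereal D1) (ereal D12) = 1 - bin_entropy D12 / ln 2"
  unfolding sc_sum_rate_def
proof (rule cInf_eq_minimum)
  let ?R2 = "(bin_entropy D1 - bin_entropy D12) / ln 2"
  have "sc_achievable bss hamming (rate_dist bss hamming D1) ?R2 (ereal D1) (ereal D12)"
    unfolding sc_achievable_def md_achievable_def
  proof (intro allI impI)
    fix eps :: real assume "0 < eps"
    have R1: "rate_dist bss hamming D1 = 1 - bin_entropy D1 / ln 2"
      using assms by (intro rate_dist_bss) auto
    have "md_code_ok bss hamming (rate_dist bss hamming D1) ?R2 (ereal D1) \<infinity> (ereal D12) eps n M1 M2 f1 f2 g1 g2 g12"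
      if "md_code_ok bss hamming (1 - bin_entropy D1 / ln 2) ?R2 (ereal D1) (ereal (1 / 2 + D12 - D1)) (ereal D12) eps n M1 M2 f1 f2 g1 g2 g12"
      for n M1 M2 f1 f2 g1 g2 g12
      using that by (simp add: md_code_ok_def R1)
    then show "\<exists>N. \<forall>n\<ge>N. \<exists>M1 M2 f1 f2 g1 g2 g12.
        md_code_ok bss hamming (rate_dist bss hamming D1) ?R2 (ereal D1) \<infinity> (ereal D12) eps n M1 M2 f1 f2 g1 g2 g12"
      using bss_md_achievable[OF assms] \<open>0 < eps\<close> unfolding md_achievable_def by meson
  qed
  moreover have "1 - bin_entropy D12 / ln 2 = rate_dist bss hamming D1 + ?R2"
    using assms by (simp add: rate_dist_bss diff_divide_distrib)
  ultimately show "1 - bin_entropy D12 / ln 2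
      \<in> {rate_dist bss hamming D1 + R2 |R2. sc_achievable bss hamming (rate_dist bss hamming D1) R2 (ereal D1) (ereal D12)}"
    by blast
next
  fix R assume "R \<in> {rate_dist bss hamming D1 + R2 |R2. sc_achievable bss hamming (rate_dist bss hamming D1) R2 (ereal D1) (ereal D12)}"
  then show "1 - bin_entropy D12 / ln 2 \<le> R"
    using bss_sum_rate_ge[of D12] assms by (auto simp: sc_achievable_def)
qed

section \<open>Choice of the slacks and the final bound\<close>

text \<open>First the test parameter \<open>\<theta>\<close> is fixed, then the slack \<open>\<kappa>\<close> is made small compared to it.\<close>
lemma second_dist_slack:
  assumes D: "0 \<le> D12" "D12 \<le> D1" "D1 < 1 / 2" and "0 < \<zeta>"
  obtains \<kappa> \<theta> where "0 < \<kappa>" "0 < \<theta>" "\<theta> \<le> 1 / 2" "D12 + \<kappa> \<le> 1 / 2"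
    "((\<kappa> + bin_entropy (D12 + \<kappa>) - bin_entropy D12) / \<theta> + \<theta> + 2 * corr_slack D1 \<kappa> \<theta>) / (2 * (1 - 2 * D1))
      + \<kappa> + 2 * corr_slack D12 \<kappa> \<theta> \<le> \<zeta>"
proof -
  define p where "p = 1 / (2 * (1 - 2 * D1))"
  define L1 where "L1 = 1 + ln (1 - D1) - ln D1"
  define L12 where "L12 = 1 + ln (1 - D12) - ln D12"
  have p: "0 < p" using D by (simp add: p_def)
  have L: "0 < L1" "0 < L12" using ln_odds_nonneg[of D1] ln_odds_nonneg[of D12] D by (auto simp: L1_def L12_def)
  \<comment> \<open>\<open>A\<close> collects the coefficients of \<theta>. \<open>C\<close>
    collects those of \<eta> / \<theta>, once \<kappa> and the entropy increment are both bounded by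
    \<eta> and the bare \<kappa> by \<kappa> / \<theta>. Each group is then given half of
    \<zeta>.\<close>
  define A where "A = 5 * p + 4"
  define C where "C = 2 * p + 2 * p * L1 + 1 + 2 * L12"
  have AC: "0 < A" "0 < C" using p L by (auto simp: A_def C_def intro!: add_pos_pos)
  define \<theta> where "\<theta> = min (1 / 2) (\<zeta> / (2 * A))"
  have \<theta>: "0 < \<theta>" "\<theta> \<le> 1 / 2" "\<theta> * A \<le> \<zeta> / 2"
  proof -
    show "0 < \<theta>" "\<theta> \<le> 1 / 2" using \<open>0 < \<zeta>\<close> AC by (auto simp: \<theta>_def)
    have "\<theta> \<le> \<zeta> / (2 * A)" by (simp add: \<theta>_def)
    then show "\<theta> * A \<le> \<zeta> / 2" using AC by (simp add: field_simps)
  qed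
  define \<eta> where "\<eta> = \<zeta> * \<theta> / (2 * C)"
  have \<eta>: "0 < \<eta>" "\<eta> * C / \<theta> = \<zeta> / 2" using \<open>0 < \<zeta>\<close> \<theta> AC by (auto simp: \<eta>_def)
  obtain \<delta> where \<delta>: "0 < \<delta>" "\<And>y. \<bar>y - D12\<bar> < \<delta> \<Longrightarrow> \<bar>bin_entropy y - bin_entropy D12\<bar> < \<eta>"
    using bin_entropy_eps_delta[OF \<eta>(1), of D12] by blast
  define \<kappa> where "\<kappa> = min \<eta> (min (\<delta> / 2) (1 / 2 - D12))"
  have \<kappa>: "0 < \<kappa>" "\<kappa> \<le> \<eta>" "\<kappa> < \<delta>" "D12 + \<kappa> \<le> 1 / 2"
  proof -
    show "0 < \<kappa>" using \<eta> \<delta> D by (simp add: \<kappa>_def)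
    have "\<kappa> \<le> \<eta>" "\<kappa> \<le> \<delta> / 2" "\<kappa> \<le> 1 / 2 - D12"
      unfolding \<kappa>_def by (simp_all only: min_le_iff_disj order_refl simp_thms)
    then show "\<kappa> \<le> \<eta>" "\<kappa> < \<delta>" "D12 + \<kappa> \<le> 1 / 2" using \<delta> by linarith+
  qed
  define h where "h = bin_entropy (D12 + \<kappa>) - bin_entropy D12"
  have h: "h \<le> \<eta>" using \<delta>(2)[of "D12 + \<kappa>"] \<kappa> by (simp add: h_def)
  have "(\<kappa> + h) / \<theta> * p + \<theta> * p + 2 * (2 * \<theta> + \<kappa> * L1 / \<theta>) * p + \<kappa> + 2 * (2 * \<theta> + \<kappa> * L12 / \<theta>)
      = \<theta> * A + (p * (\<kappa> + h) + 2 * p * L1 * \<kappa> + \<theta> * \<kappa> + 2 * L12 * \<kappa>) / \<theta>"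
    using \<theta>(1) by (simp add: A_def field_simps)
  also have "\<dots> \<le> \<theta> * A + (p * (\<eta> + \<eta>) + 2 * p * L1 * \<eta> + 1 * \<eta> + 2 * L12 * \<eta>) / \<theta>"
    using \<theta> p L \<kappa> h by (intro add_mono divide_right_mono mult_left_mono mult_mono) auto
  also have "\<dots> = \<theta> * A + \<eta> * C / \<theta>"
    by (simp add: C_def algebra_simps)
  also have "\<dots> \<le> \<zeta> / 2 + \<zeta> / 2"
    unfolding \<eta>(2) by (rule add_right_mono[OF \<theta>(3)])
  also have "\<dots> = \<zeta>" by simp
  finally have "((\<kappa> + h) / \<theta> + \<theta> + 2 * corr_slack D1 \<kappa> \<theta>) * p + \<kappa> + 2 * corr_slack D12 \<kappa> \<theta> \<le> \<zeta>"
    by (simp add: corr_slack_def L1_def L12_def algebra_simps)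
  then show ?thesis
    using \<kappa> \<theta> by (intro that[of \<kappa> \<theta>]) (auto simp: h_def p_def add_diff_eq)
qed

lemma joint_slack:
  assumes "0 \<le> D" "D \<le> 1 / 2" "0 < \<zeta>"
  obtains \<kappa> \<theta> where "0 < \<kappa>" "0 < \<theta>" "\<theta> \<le> 1 / 2" "corr_slack D \<kappa> \<theta> \<le> \<zeta>"
proof -
  define L where "L = 1 + ln (1 - D) - ln D"
  have L: "0 < L" using ln_odds_nonneg[of D] assms by (simp add: L_def)
  define \<theta> where "\<theta> = min (1 / 2) (\<zeta> / 4)"
  have \<theta>: "0 < \<theta>" "\<theta> \<le> 1 / 2" "\<theta> \<le> \<zeta> / 4"
  proof -
    show "0 < \<theta>" using assms by (simp add: \<theta>_def)
    show "\<theta> \<le> 1 / 2" "\<theta> \<le> \<zeta> / 4"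
      unfolding \<theta>_def by (simp_all only: min_le_iff_disj order_refl simp_thms)
  qed
  have "corr_slack D (\<zeta> * \<theta> / (2 * L)) \<theta> = 2 * \<theta> + \<zeta> / 2"
    using \<theta> L by (simp add: corr_slack_def L_def[symmetric])
  then show ?thesis
    using \<theta> L assms by (intro that[of "\<zeta> * \<theta> / (2 * L)" \<theta>]) auto
qed

text \<open>The converse argues with one code at one positive block length. The slack of the second
  distortion is kept apart from \<kappa>, since \<kappa> is chosen depending on the final
  accuracy.\<close>

lemma bss_code:
  assumes R: "R1 = 1 - bin_entropy D1 / ln 2" "R1 + R2 = 1 - bin_entropy D12 / ln 2"
    and ach: "md_achievable bss hamming R1 R2 (ereal D1) (ereal D2) (ereal D12)"
    and \<kappa>: "0 < \<kappa>" and e: "0 < e"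
  obtains n M1 M2 f1 f2 g1 g2 g12 where "0 < n"
    "\<forall>x\<in>nlists n UNIV. f1 x \<in> {..<M1 :: nat}" "\<forall>x\<in>nlists n UNIV. f2 x \<in> {..<M2 :: nat}"
    "total_avg n (\<lambda>x t. hamming (x ! t) (g1 (f1 x) t)) \<le> real n * (D1 + \<kappa>)"
    "total_avg n (\<lambda>x t. hamming (x ! t) (g2 (f2 x) t)) \<le> real n * (D2 + e)"
    "total_avg n (\<lambda>x t. hamming (x ! t) (g12 (f1 x) (f2 x) t)) \<le> real n * (D12 + \<kappa>)"
    "ln (card {..<M1}) \<le> real n * (ln 2 - bin_entropy D1 + \<kappa>)"
    "ln (card {..<M1}) + ln (card {..<M2}) \<le> real n * (ln 2 - bin_entropy D12 + \<kappa>)"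
proof -
  \<comment> \<open>The sum rate carries the slack twice, hence the half; passing to nats only
    shrinks it because \<open>ln 2 < 1\<close>.\<close>
  define eps where "eps = min (\<kappa> / 2) (e)"
  have eps: "0 < eps" "2 * eps \<le> \<kappa>" "eps \<le> e"
    using \<kappa> e by (auto simp: eps_def min_def)
  have eps_ln: "k * eps * ln 2 \<le> \<kappa>" if "0 \<le> k" "k \<le> 2" for k
  proof -
    have "k * eps * ln 2 \<le> 2 * eps * 1" using eps that ln_2_less_1 by (intro mult_mono) auto
    then show ?thesis using eps by linarith
  qed
  obtain N where N: "\<And>n. n \<ge> N \<Longrightarrow> \<exists>M1 M2 f1 f2 g1 g2 g12.
      md_code_ok bss hamming R1 R2 (ereal D1) (ereal D2) (ereal D12) eps n M1 M2 f1 f2 g1 g2 g12"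
    using ach eps unfolding md_achievable_def by blast
  define n where "n = Suc N"
  have n: "0 < n" by (simp add: n_def)
  obtain M1 M2 f1 f2 g1 g2 g12 where ok: "md_code_ok bss hamming R1 R2 (ereal D1) (ereal D2) (ereal D12) eps n M1 M2 f1 f2 g1 g2 g12"
    using N[of n] by (auto simp: n_def)
  have r: "log 2 (real M1) / real n \<le> R1 + eps" "log 2 (real M2) / real n \<le> R2 + eps"
    using ok by (simp_all add: md_code_ok_def)
  have "ln (real M1) \<le> real n * ((R1 + eps) * ln 2)"
    by (rule ln_rate_le[OF r(1) n])
  also have "\<dots> = real n * (ln 2 - bin_entropy D1 + 1 * eps * ln 2)"
    unfolding R(1) by (simp add: field_simps)
  also have "\<dots> \<le> real n * (ln 2 - bin_entropy D1 + \<kappa>)"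
    using eps_ln[of 1] by (intro mult_left_mono add_left_mono) auto
  finally have rate1: "ln (real M1) \<le> real n * (ln 2 - bin_entropy D1 + \<kappa>)" .
  have "ln (real M1) + ln (real M2) \<le> real n * ((R1 + eps) * ln 2) + real n * ((R2 + eps) * ln 2)"
    by (intro add_mono ln_rate_le r n)
  also have "\<dots> = real n * ((R1 + R2) * ln 2 + 2 * eps * ln 2)"
    by (simp add: algebra_simps)
  also have "\<dots> = real n * (ln 2 - bin_entropy D12 + 2 * eps * ln 2)"
    unfolding R(2) by (simp add: left_diff_distrib)
  also have "\<dots> \<le> real n * (ln 2 - bin_entropy D12 + \<kappa>)"
    using eps_ln[of 2] by (intro mult_left_mono add_left_mono) auto
  finally have rate12: "ln (real M1) + ln (real M2) \<le> real n * (ln 2 - bin_entropy D12 + \<kappa>)" .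
  have "exp_dist bss hamming n (\<lambda>x. g1 (f1 x)) \<le> D1 + \<kappa>" "exp_dist bss hamming n (\<lambda>x. g2 (f2 x)) \<le> D2 + e"
    "exp_dist bss hamming n (\<lambda>x. g12 (f1 x) (f2 x)) \<le> D12 + \<kappa>"
    using ok eps by (simp_all add: md_code_ok_def)
  then have dist: "total_avg n (\<lambda>x t. hamming (x ! t) (g1 (f1 x) t)) \<le> real n * (D1 + \<kappa>)"
    "total_avg n (\<lambda>x t. hamming (x ! t) (g2 (f2 x) t)) \<le> real n * (D2 + e)"
    "total_avg n (\<lambda>x t. hamming (x ! t) (g12 (f1 x) (f2 x) t)) \<le> real n * (D12 + \<kappa>)"
    by (simp_all only: exp_dist_total_avg[OF n])
  have mem: "\<forall>x\<in>nlists n UNIV. f1 x \<in> {..<M1}" "\<forall>x\<in>nlists n UNIV. f2 x \<in> {..<M2}"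
    using ok by (auto simp: md_code_ok_def)
  show ?thesis
    by (rule that[OF n mem dist]) (use rate1 rate12 in simp_all)
qed

lemma bss_second_dist_ge:
  assumes D: "0 \<le> D12" "D12 \<le> D1" "D1 \<le> 1 / 2"
    and R: "R1 = 1 - bin_entropy D1 / ln 2" "R1 + R2 = 1 - bin_entropy D12 / ln 2"
    and ach: "md_achievable bss hamming R1 R2 (ereal D1) (ereal D2) (ereal D12)"
  shows "1 / 2 + D12 - D1 \<le> D2"
proof (rule field_le_epsilon)
  fix e :: real assume e: "0 < e"
  then have e2: "0 < e / 2" by simp
  show "1 / 2 + D12 - D1 \<le> D2 + e"
  proof (cases "D1 < 1 / 2")
    case True
    obtain \<kappa> \<theta> where sl: "0 < \<kappa>" "0 < \<theta>" "\<theta> \<le> 1 / 2" "D12 + \<kappa> \<le> 1 / 2"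
      and slack: "((\<kappa> + bin_entropy (D12 + \<kappa>) - bin_entropy D12) / \<theta> + \<theta> + 2 * corr_slack D1 \<kappa> \<theta>) / (2 * (1 - 2 * D1))
        + \<kappa> + 2 * corr_slack D12 \<kappa> \<theta> \<le> e / 2"
      using second_dist_slack[OF D(1,2) True e2] by blast
    obtain n f1 f2 g1 g2 g12 M1 M2 where code: "0 < n"
      "\<forall>x\<in>nlists n UNIV. f1 x \<in> {..<M1 :: nat}" "\<forall>x\<in>nlists n UNIV. f2 x \<in> {..<M2 :: nat}"
      "total_avg n (\<lambda>x t. hamming (x ! t) (g1 (f1 x) t)) \<le> real n * (D1 + \<kappa>)"
      "total_avg n (\<lambda>x t. hamming (x ! t) (g2 (f2 x) t)) \<le> real n * (D2 + e / 2)"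
      "total_avg n (\<lambda>x t. hamming (x ! t) (g12 (f1 x) (f2 x) t)) \<le> real n * (D12 + \<kappa>)"
      "ln (card {..<M1}) \<le> real n * (ln 2 - bin_entropy D1 + \<kappa>)"
      "ln (card {..<M1}) + ln (card {..<M2}) \<le> real n * (ln 2 - bin_entropy D12 + \<kappa>)"
      by (rule bss_code[OF R ach sl(1) e2], rule that, assumption+)
    interpret md_code n f1 f2 "{..<M1}" "{..<M2}" g2 g12 D12 \<kappa> \<theta>
      using D sl code by unfold_locales (blast | simp)+
    have "real n * (1 / 2 + D12 - D1) \<le> total_avg n (\<lambda>x t. hamming (x ! t) (g2 (f2 x) t)) + real n *
      (((\<kappa> + bin_entropy (D12 + \<kappa>) - bin_entropy D12) / \<theta> + \<theta> + 2 * corr_slack D1 \<kappa> \<theta>) / (2 * (1 - 2 * D1))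
        + \<kappa> + 2 * corr_slack D12 \<kappa> \<theta>)"
      by (rule second_dist_ge[OF D(2) True sl(4) code(4,7)])
    also have "\<dots> \<le> real n * (D2 + e / 2) + real n * (e / 2)"
      by (intro add_mono code(5) mult_left_mono slack) simp
    also have "\<dots> = real n * (D2 + e)" by (simp add: algebra_simps)
    finally show ?thesis using code(1) by simp
  next
    case False
    \<comment> \<open>Here D1 = 1/2 and the claim reads D12 \<le> D2, which
      \<open>second_dist_ge_joint\<close> gives.\<close>
    have D12le: "D12 \<le> 1 / 2" using D by simp
    obtain \<kappa> \<theta> where sl: "0 < \<kappa>" "0 < \<theta>" "\<theta> \<le> 1 / 2" and slack: "corr_slack D12 \<kappa> \<theta> \<le> e / 2"
      using joint_slack[OF D(1) D12le e2] by blast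
    obtain n f1 f2 g1 g2 g12 M1 M2 where code: "0 < n"
      "\<forall>x\<in>nlists n UNIV. f1 x \<in> {..<M1 :: nat}" "\<forall>x\<in>nlists n UNIV. f2 x \<in> {..<M2 :: nat}"
      "total_avg n (\<lambda>x t. hamming (x ! t) (g1 (f1 x) t)) \<le> real n * (D1 + \<kappa>)"
      "total_avg n (\<lambda>x t. hamming (x ! t) (g2 (f2 x) t)) \<le> real n * (D2 + e / 2)"
      "total_avg n (\<lambda>x t. hamming (x ! t) (g12 (f1 x) (f2 x) t)) \<le> real n * (D12 + \<kappa>)"
      "ln (card {..<M1}) \<le> real n * (ln 2 - bin_entropy D1 + \<kappa>)"
      "ln (card {..<M1}) + ln (card {..<M2}) \<le> real n * (ln 2 - bin_entropy D12 + \<kappa>)"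
      by (rule bss_code[OF R ach sl(1) e2], rule that, assumption+)
    interpret md_code n f1 f2 "{..<M1}" "{..<M2}" g2 g12 D12 \<kappa> \<theta>
      using D D12le sl code by unfold_locales (blast | simp)+
    have "real n * D12 \<le> total_avg n (\<lambda>x t. hamming (x ! t) (g2 (f2 x) t)) + real n * corr_slack D12 \<kappa> \<theta>"
      by (rule second_dist_ge_joint)
    also have "\<dots> \<le> real n * (D2 + e / 2) + real n * (e / 2)"
      by (intro add_mono code(5) mult_left_mono slack) simp
    also have "\<dots> = real n * (D2 + e)" by (simp add: algebra_simps)
    finally show ?thesis using code(1) False D by simp
  qed
qed

theorem theorem5:
  fixes D1 D12 :: real
  assumes "0 \<le> D12" and "D12 \<le> D1" and "D1 \<le> 1 / 2"
  shows "ereal (1 / 2 + D12 - D1) \<in> Dstar2_set bss hamming D1 D12 \<and>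
         (\<forall>D2\<in>Dstar2_set bss hamming D1 D12. ereal (1 / 2 + D12 - D1) \<le> D2)"
proof -
  have R1: "rate_dist bss hamming D1 = 1 - bin_entropy D1 / ln 2"
    using assms by (intro rate_dist_bss) auto
  note sum_rate = sc_sum_rate_bss[OF assms]
  have "ereal (1 / 2 + D12 - D1) \<in> Dstar2_set bss hamming D1 D12"
    unfolding Dstar2_set_def
  proof (intro CollectI exI conjI)
    show "rate_dist bss hamming D1 + (bin_entropy D1 - bin_entropy D12) / ln 2
        = sc_sum_rate bss hamming (rate_dist bss hamming D1) (ereal D1) (ereal D12)"
      unfolding sum_rate unfolding R1 by (simp add: diff_divide_distrib)
    show "md_achievable bss hamming (rate_dist bss hamming D1) ((bin_entropy D1 - bin_entropy D12) / ln 2)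
        (ereal D1) (ereal (1 / 2 + D12 - D1)) (ereal D12)"
      unfolding R1 by (rule bss_md_achievable[OF assms])
  qed simp
  moreover have "ereal (1 / 2 + D12 - D1) \<le> D2" if "D2 \<in> Dstar2_set bss hamming D1 D12" for D2
  proof -
    from that obtain R2 where
      R2: "rate_dist bss hamming D1 + R2 = sc_sum_rate bss hamming (rate_dist bss hamming D1) (ereal D1) (ereal D12)"
      and ach: "md_achievable bss hamming (rate_dist bss hamming D1) R2 (ereal D1) D2 (ereal D12)"
      unfolding Dstar2_set_def by blast
    show "ereal (1 / 2 + D12 - D1) \<le> D2"
    proof (cases D2)
      case (real r)
      then show ?thesis
        using bss_second_dist_ge[OF assms R1 _ ach[unfolded real]] R2 sum_rate by simp
    next
      \<comment> \<open>An expected distortion is a real number and cannot be at most minus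
        infinity, so no code exists.\<close>
      case MInf
      obtain N where "\<forall>n\<ge>N. \<exists>M1 M2 f1 f2 g1 g2 g12.
          md_code_ok bss hamming (rate_dist bss hamming D1) R2 (ereal D1) D2 (ereal D12) 1 n M1 M2 f1 f2 g1 g2 g12"
        using ach unfolding md_achievable_def by (meson zero_less_one)
      then have False using MInf by (auto simp: md_code_ok_def)
      then show ?thesis ..
    qed simp
  qed
  ultimately show ?thesis by blast
qed

end
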